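(* Let $\kappa$ be a cardinal. Then $\kappa$ is lightface $\Sigma^1_2$-indescribable if and only if $\kappa$ is inaccessible and $H_\kappa \prec_{\Sigma_2} H_{\kappa^+}$.
   Context: $H_\lambda$ denotes the set of all sets whose transitive closure has cardinality less than $\lambda$. $H_\kappa \prec_{\Sigma_2} H_{\kappa^+}$ means that for every $\Sigma_2$ formula $\phi$ in the language of set theory and all parameters from $H_\kappa$, $\phi$ holds in $H_\kappa$ if and only if it holds in $H_{\kappa^+}$. A cardinal $\kappa$ has the $\Sigma^1_2$ reflection property if, whenever $V_\kappa \vDash \exists X \forall Y\, \Phi(X,Y,p)$, where $\Phi$ is a first-order formula in the language of set theory with $X$ and $Y$ as additional predicates and $p \in V_\kappa$, there is $\xi<\kappa$ (with $p\in V_\xi$) such that $V_\xi \vDash \exists X \forall Y\, \Phi(X,Y,p)$. Here the second-order quantifiers, when interpreted in a structure with universe $M$, range over all subsets of $M$. A cardinal $\kappa$ is (lightface) $\Sigma^1_2$-indescribable if it has the $\Sigma^1_2$ reflection property and is inaccessible (uncountable, regular and strong limit). *)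

theory Defs
  imports Main "HOL-Library.Equipollence" "HOL-Library.Countable_Set"
begin

text \<open>
  First-order formulas over membership and equality with two additional unary predicate
  symbols X and Y. Variables are natural numbers.
\<close>

datatype fm =
    Mem nat nat
  | Eq nat nat
  | InX nat
  | InY nat
  | Neg fm
  | And fm fm
  | Forall nat fm

definition Imp :: "fm \<Rightarrow> fm \<Rightarrow> fm" where
  "Imp \<phi> \<psi> = Neg (And \<phi> (Neg \<psi>))"

definition Exists :: "nat \<Rightarrow> fm \<Rightarrow> fm" where
  "Exists i \<phi> = Neg (Forall i (Neg \<phi>))"

text \<open>
  The Levy hierarchy of formulas in the language of set theory. There are no rules for the atoms
  \<^const>\<open>InX\<close> and \<^const>\<open>InY\<close>, so the formulas below mention neither X nor Y.
  Bounded existential quantification and the remaining connectives are obtained by negation.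
\<close>

inductive_set Delta0 :: "fm set" where
  "Mem i j \<in> Delta0"
| "Eq i j \<in> Delta0"
| "\<phi> \<in> Delta0 \<Longrightarrow> Neg \<phi> \<in> Delta0"
| "\<phi> \<in> Delta0 \<Longrightarrow> \<psi> \<in> Delta0 \<Longrightarrow> And \<phi> \<psi> \<in> Delta0"
| "\<phi> \<in> Delta0 \<Longrightarrow> i \<noteq> j \<Longrightarrow> Forall i (Imp (Mem i j) \<phi>) \<in> Delta0"

fun Sigma_fm :: "nat \<Rightarrow> fm set" and Pi_fm :: "nat \<Rightarrow> fm set" where
  "Sigma_fm 0 = Delta0"
| "Pi_fm 0 = Delta0"
| "Sigma_fm (Suc n) = {foldr Exists vs \<phi> |vs \<phi>. \<phi> \<in> Pi_fm n}"
| "Pi_fm (Suc n) = {foldr Forall vs \<phi> |vs \<phi>. \<phi> \<in> Sigma_fm n}"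

text \<open>
  The ambient universe of sets: the elements of the type \<open>'v\<close> are the sets, and
  \<open>elts x\<close> is the collection of members of \<open>x\<close>. The axioms are those of ZFC with
  foundation stated for all classes and replacement for all class functions. Separation and pairing
  follow from the axioms given, and choice follows from replacement and the choice operator of HOL.
\<close>

locale zfc_universe =
  fixes elts :: "'v \<Rightarrow> 'v set"
  assumes extensionality: "elts x = elts y \<Longrightarrow> x = y"
    and foundation: "wf {(y, x). y \<in> elts x}"
    and union: "\<exists>u. elts u = (\<Union>y\<in>elts x. elts y)"
    and power: "\<exists>p. elts p = {y. elts y \<subseteq> elts x}"
    and infinity: "\<exists>w. (\<exists>z\<in>elts w. elts z = {}) \<and>
      (\<forall>y\<in>elts w. \<exists>s\<in>elts w. elts s = insert y (elts y))"
    and replacement: "\<exists>y. elts y = F ` elts x"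
begin

text \<open>
  By replacement, every function in HOL between the members of two sets is itself a set, so the
  comparison of cardinalities may be expressed by \<^const>\<open>lesspoll\<close> and
  \<^const>\<open>eqpoll\<close>.
\<close>

definition tc :: "'v \<Rightarrow> 'v set" where
  "tc x = {y. (y, x) \<in> {(y, x). y \<in> elts x}\<^sup>+}"

definition transitive :: "'v \<Rightarrow> bool" where
  "transitive x \<longleftrightarrow> (\<forall>y\<in>elts x. elts y \<subseteq> elts x)"

definition ordinal :: "'v \<Rightarrow> bool" where
  "ordinal \<alpha> \<longleftrightarrow> transitive \<alpha> \<and> (\<forall>\<beta>\<in>elts \<alpha>. transitive \<beta>)"

definition cardinal :: "'v \<Rightarrow> bool" where
  "cardinal \<kappa> \<longleftrightarrow> ordinal \<kappa> \<and> (\<forall>\<alpha>\<in>elts \<kappa>. \<not> elts \<alpha> \<approx> elts \<kappa>)"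

definition card_succ :: "'v \<Rightarrow> 'v" where
  "card_succ \<kappa> = (THE \<mu>. cardinal \<mu> \<and> \<kappa> \<in> elts \<mu> \<and>
     (\<forall>\<nu>. cardinal \<nu> \<and> \<kappa> \<in> elts \<nu> \<longrightarrow> elts \<mu> \<subseteq> elts \<nu>))"

definition unbounded_in :: "'v set \<Rightarrow> 'v \<Rightarrow> bool" where
  "unbounded_in A \<kappa> \<longleftrightarrow> A \<subseteq> elts \<kappa> \<and> (\<forall>\<beta>\<in>elts \<kappa>. \<exists>\<alpha>\<in>A. elts \<beta> \<subseteq> elts \<alpha>)"

definition regular :: "'v \<Rightarrow> bool" where
  "regular \<kappa> \<longleftrightarrow> cardinal \<kappa> \<and> infinite (elts \<kappa>) \<and>
     (\<forall>A. unbounded_in A \<kappa> \<longrightarrow> \<not> A \<prec> elts \<kappa>)"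

definition strong_limit :: "'v \<Rightarrow> bool" where
  "strong_limit \<kappa> \<longleftrightarrow> cardinal \<kappa> \<and> (\<forall>\<alpha>\<in>elts \<kappa>. Pow (elts \<alpha>) \<prec> elts \<kappa>)"

definition inaccessible :: "'v \<Rightarrow> bool" where
  "inaccessible \<kappa> \<longleftrightarrow> uncountable (elts \<kappa>) \<and> regular \<kappa> \<and> strong_limit \<kappa>"

definition H :: "'v \<Rightarrow> 'v set" where
  "H \<kappa> = {x. tc x \<prec> elts \<kappa>}"

text \<open>The cumulative hierarchy.\<close>

function V :: "'v \<Rightarrow> 'v set" where
  "V \<alpha> = (\<Union>\<beta>\<in>elts \<alpha>. {x. elts x \<subseteq> V \<beta>})"
  by auto
termination
  by (relation "{(y, x). y \<in> elts x}") (auto intro: foundation)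

declare V.simps [simp del]

text \<open>
  Satisfaction in the structure with universe \<open>M\<close>, where the predicate symbols are
  interpreted by \<open>X\<close> and \<open>Y\<close> and the free variables by the assignment
  \<open>e\<close>.
\<close>

primrec sat :: "'v set \<Rightarrow> 'v set \<Rightarrow> 'v set \<Rightarrow> (nat \<Rightarrow> 'v) \<Rightarrow> fm \<Rightarrow> bool" where
  "sat M X Y e (Mem i j) \<longleftrightarrow> e i \<in> elts (e j)"
| "sat M X Y e (Eq i j) \<longleftrightarrow> e i = e j"
| "sat M X Y e (InX i) \<longleftrightarrow> e i \<in> X"
| "sat M X Y e (InY i) \<longleftrightarrow> e i \<in> Y"
| "sat M X Y e (Neg \<phi>) \<longleftrightarrow> \<not> sat M X Y e \<phi>"
| "sat M X Y e (And \<phi> \<psi>) \<longleftrightarrow> sat M X Y e \<phi> \<and> sat M X Y e \<psi>"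
| "sat M X Y e (Forall i \<phi>) \<longleftrightarrow> (\<forall>a\<in>M. sat M X Y (e(i := a)) \<phi>)"

text \<open>
  The formulas in \<^term>\<open>Sigma_fm n\<close> do not contain X and Y, so the interpretation of these
  two symbols by the empty set is immaterial.
\<close>

definition Sigma_elementary :: "nat \<Rightarrow> 'v set \<Rightarrow> 'v set \<Rightarrow> bool" where
  "Sigma_elementary n M N \<longleftrightarrow>
     (\<forall>\<phi>\<in>Sigma_fm n. \<forall>e. range e \<subseteq> M \<longrightarrow> (sat M {} {} e \<phi> \<longleftrightarrow> sat N {} {} e \<phi>))"

text \<open>
  \<open>M \<Turnstile> \<exists>X \<forall>Y \<Phi>(X, Y, p)\<close>, the second-order quantifiers ranging over all
  subsets of \<open>M\<close>. The constant assignment gives each free variable of \<open>\<Phi>\<close>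
  the value \<open>p\<close>, so no convention on the name of the parameter variable is needed.
\<close>

definition sat_Sigma12 :: "'v set \<Rightarrow> fm \<Rightarrow> 'v \<Rightarrow> bool" where
  "sat_Sigma12 M \<Phi> p \<longleftrightarrow> (\<exists>X. X \<subseteq> M \<and> (\<forall>Y. Y \<subseteq> M \<longrightarrow> sat M X Y (\<lambda>_. p) \<Phi>))"

definition Sigma12_reflection :: "'v \<Rightarrow> bool" where
  "Sigma12_reflection \<kappa> \<longleftrightarrow>
     (\<forall>\<Phi>. \<forall>p\<in>V \<kappa>. sat_Sigma12 (V \<kappa>) \<Phi> p \<longrightarrow>
        (\<exists>\<xi>\<in>elts \<kappa>. p \<in> V \<xi> \<and> sat_Sigma12 (V \<xi>) \<Phi> p))"

definition Sigma12_indescribable :: "'v \<Rightarrow> bool" where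
  "Sigma12_indescribable \<kappa> \<longleftrightarrow> Sigma12_reflection \<kappa> \<and> inaccessible \<kappa>"

end

end

theory Submission
  imports Defs
begin

text \<open>
  From right to left, \<open>V \<xi> \<Turnstile> \<exists>X \<forall>Y \<Phi>(X, Y, p)\<close> for some \<open>\<xi>\<close> is a
  \<open>\<Sigma>\<^sub>2\<close> statement about \<open>p\<close>, which \<open>\<xi> = \<kappa>\<close> witnesses in the larger structure.

  From left to right, upward preservation follows from a Loewenheim-Skolem argument. For downward
  preservation, let \<open>\<exists>x \<forall>y \<delta>(x, y, p)\<close> hold in the larger structure. Code a transitive set
  that includes \<open>V \<kappa>\<close> and contains \<open>x\<close> by a well-founded extensional relation
  \<open>X\<close> on \<open>V \<kappa>\<close>, and say that every relation \<open>Y\<close> that codes a larger transitive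
  set satisfies \<open>\<delta>\<close>. That \<open>X\<close> is well-founded can be said with the quantifier over
  \<open>Y\<close>. For \<open>Y\<close> this would have the wrong quantifier complexity, so \<open>Y\<close> is only
  required to have a minimal element in every nonempty \<^emph>\<open>element\<close> of the universe. This is first
  order, implies well-foundedness over \<open>V \<kappa>\<close> because \<open>V \<kappa>\<close> is closed under countable
  subsets, and is implied by it everywhere. In the reflected \<open>V \<xi>\<close>, which need not be closed
  under countable subsets, \<open>X\<close> decodes to a witness: a counterexample \<open>y\<close> would, by
  Loewenheim-Skolem, occur in a transitive set of size at most that of \<open>V \<xi>\<close>, hence in one
  coded by some \<open>Y\<close>.
\<close>

subsection \<open>Cardinality and smallness\<close>

lemma lepoll_UN_infinite:
  assumes "infinite K" "I \<lesssim> K" "\<And>i. i \<in> I \<Longrightarrow> A i \<lesssim> K"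
  shows "(\<Union>i\<in>I. A i) \<lesssim> K"
  using card_of_UNION_ordLeq_infinite[of K I A] assms
  by (simp add: lepoll_def card_of_ordLeq)

lemma lepoll_times_infinite:
  assumes "infinite K" "A \<lesssim> K" "B \<lesssim> K"
  shows "A \<times> B \<lesssim> K"
proof -
  have "A \<times> B = (\<Union>a\<in>A. Pair a ` B)" by auto
  moreover have "Pair a ` B \<lesssim> K" for a
    using assms(3) image_lepoll lepoll_trans by blast
  ultimately show ?thesis
    using lepoll_UN_infinite[OF assms(1,2)] by metis
qed

lemma lepoll_Un_infinite:
  assumes "infinite K" "A \<lesssim> K" "B \<lesssim> K"
  shows "A \<union> B \<lesssim> K"
proof -
  have "finite (UNIV :: bool set)" by simp
  then have "(UNIV :: bool set) \<lesssim> K"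
    using assms(1) finite_lepoll_infinite by blast
  then have "(\<Union>b\<in>(UNIV::bool set). if b then A else B) \<lesssim> K"
    by (rule lepoll_UN_infinite[OF assms(1)]) (use assms in auto)
  moreover have "(\<Union>b\<in>(UNIV::bool set). if b then A else B) = A \<union> B"
    by (auto split: if_splits)
  ultimately show ?thesis by simp
qed

lemma countable_lepoll_infinite:
  assumes "countable A" "infinite K"
  shows "A \<lesssim> K"
proof -
  have "A \<lesssim> (UNIV :: nat set)"
    using assms(1) unfolding countable_def lepoll_def by auto
  then show ?thesis
    using assms(2) infinite_le_lepoll lepoll_trans by blast
qed

lemma lepoll_UN_nat:
  fixes A :: "nat \<Rightarrow> 'a set"
  assumes "infinite K" "\<And>n. A n \<lesssim> K"
  shows "(\<Union>n. A n) \<lesssim> K"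
  by (rule lepoll_UN_infinite[OF assms(1)]) (use assms in \<open>auto intro: countable_lepoll_infinite\<close>)

lemma lists_lepoll_infinite:
  assumes "infinite K" "A \<lesssim> K"
  shows "lists A \<lesssim> K"
proof -
  have len: "{xs \<in> lists A. length xs = n} \<lesssim> K" for n
  proof (induction n)
    case 0
    have "{xs \<in> lists A. length xs = 0} \<subseteq> {[]}" by auto
    then have "finite {xs \<in> lists A. length xs = 0}"
      by (rule finite_subset) simp
    then show ?case
      using assms(1) finite_lepoll_infinite by blast
  next
    case (Suc n)
    have "{xs \<in> lists A. length xs = Suc n} \<subseteq> (\<lambda>(x, xs). x # xs) ` (A \<times> {xs \<in> lists A. length xs = n})"
      by (auto simp: length_Suc_conv image_iff)
    then have "{xs \<in> lists A. length xs = Suc n} \<lesssim> A \<times> {xs \<in> lists A. length xs = n}"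
      by (rule subset_image_lepoll)
    also have "\<dots> \<lesssim> K"
      using assms Suc by (intro lepoll_times_infinite)
    finally show ?case .
  qed
  have "lists A = (\<Union>n. {xs \<in> lists A. length xs = n})" by auto
  moreover have "(\<Union>n. {xs \<in> lists A. length xs = n}) \<lesssim> K"
    using assms(1) len by (rule lepoll_UN_nat)
  ultimately show ?thesis by simp
qed

text \<open>The closure is the union of countably many stages, each adding the values of all
  operations on lists over the previous stage. A list over the union is finite and the stages
  increase, so it lies in one stage. Letting \<open>F\<close> act on lists handles operations of all
  arities at once.\<close>

lemma exists_closure_lepoll:
  fixes F :: "'i::countable \<Rightarrow> 'a list \<Rightarrow> 'a"
  assumes K: "infinite K" and A: "A \<lesssim> K"
  obtains N where "A \<subseteq> N" "N \<lesssim> K" "\<And>k xs. xs \<in> lists N \<Longrightarrow> F k xs \<in> N"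
proof -
  define step where "step B = B \<union> (\<lambda>(k, xs). F k xs) ` (UNIV \<times> lists B)" for B
  define S where "S n = (step ^^ n) A" for n
  have S0: "S 0 = A" and SSuc: "S (Suc n) = step (S n)" for n
    by (simp_all add: S_def)
  have SK: "S n \<lesssim> K" for n
  proof (induction n)
    case 0
    then show ?case by (simp add: S0 A)
  next
    case (Suc n)
    have "(\<lambda>(k, xs). F k xs) ` (UNIV \<times> lists (S n)) \<lesssim> (UNIV :: 'i set) \<times> lists (S n)"
      by (rule image_lepoll)
    also have "\<dots> \<lesssim> K"
      using K Suc by (intro lepoll_times_infinite lists_lepoll_infinite) (auto intro: countable_lepoll_infinite)
    finally show ?case
      using K Suc by (simp add: SSuc step_def lepoll_Un_infinite)
  qed
  have mono: "S m \<subseteq> S n" if "m \<le> n" for m n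
    by (rule lift_Suc_mono_le[OF _ that]) (simp add: SSuc step_def)
  have fin: "\<exists>n. xs \<in> lists (S n)" if "xs \<in> lists (\<Union>n. S n)" for xs
    using that
  proof (induction xs)
    case (Cons x xs)
    then obtain m n where "x \<in> S m" "xs \<in> lists (S n)" by auto
    then have "x # xs \<in> lists (S (max m n))"
      using mono[of m "max m n"] mono[of n "max m n"] by (auto simp: lists_eq_set)
    then show ?case by blast
  qed auto
  show ?thesis
  proof
    show "A \<subseteq> (\<Union>n. S n)" using S0 by auto
    show "(\<Union>n. S n) \<lesssim> K"
      using K SK by (rule lepoll_UN_nat)
    show "F k xs \<in> (\<Union>n. S n)" if xs: "xs \<in> lists (\<Union>n. S n)" for k xs
    proof -
      obtain n where "xs \<in> lists (S n)" using fin xs by blast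
      then have "F k xs \<in> S (Suc n)" by (force simp: SSuc step_def)
      then show ?thesis by blast
    qed
  qed
qed

section \<open>Classes that are sets, transitive closures and the Mostowski collapse\<close>

context zfc_universe
begin

definition small :: "'v set \<Rightarrow> bool" where
  "small A \<longleftrightarrow> (\<exists>x. elts x = A)"

text \<open>The choice is unique by \<open>extensionality\<close> when \<open>A\<close> is small;
  for a proper class the value is arbitrary, so facts about \<open>elts (mk A)\<close> come with a
  smallness condition.\<close>

definition mk :: "'v set \<Rightarrow> 'v" where
  "mk A = (SOME x. elts x = A)"

lemma elts_mk [simp]: "small A \<Longrightarrow> elts (mk A) = A"
  unfolding small_def mk_def by (rule someI_ex)

lemma small_elts [simp]: "small (elts x)"
  by (auto simp: small_def)

lemma mk_elts [simp]: "mk (elts x) = x"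
  by (simp add: extensionality)

lemma small_image [simp]: "small A \<Longrightarrow> small (F ` A)"
  unfolding small_def by (elim exE) (use replacement in metis)

lemma small_empty [simp]: "small {}"
proof -
  obtain w where "\<exists>z\<in>elts w. elts z = {}" using infinity by (elim exE conjE)
  then obtain z where "elts z = {}" by (elim bexE)
  then show ?thesis unfolding small_def by (rule exI)
qed

text \<open>This is where separation is derived from replacement: a class injecting into a set is,
  when nonempty, an image of that set.\<close>

lemma small_lepoll:
  assumes "small B" "A \<lesssim> B"
  shows "small A"
proof (cases "A = {}")
  case False
  obtain g where g: "A \<subseteq> g ` B"
    using assms(2) unfolding lepoll_iff by (elim exE)
  obtain a where "a \<in> A" using False by blast
  \<comment> \<open>\<open>g\<close> only covers \<open>A\<close>; redirecting stray values to
    \<open>a\<close> makes the image exactly \<open>A\<close>.\<close>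
  then have "A = (\<lambda>x. if g x \<in> A then g x else a) ` B"
    using g by (auto split: if_splits)
  then show ?thesis using small_image[OF assms(1)] by metis
qed simp

lemma small_subset: "small B \<Longrightarrow> A \<subseteq> B \<Longrightarrow> small A"
  by (rule small_lepoll[OF _ subset_imp_lepoll])

lemma small_Union:
  assumes "small I" "\<And>i. i \<in> I \<Longrightarrow> small (A i)"
  shows "small (\<Union>i\<in>I. A i)"
proof -
  have "small ((\<lambda>i. mk (A i)) ` I)" using assms(1) by simp
  then obtain x where x: "elts x = (\<lambda>i. mk (A i)) ` I" by (auto simp: small_def)
  obtain u where "elts u = (\<Union>y\<in>elts x. elts y)" using union by blast
  then have "elts u = (\<Union>i\<in>I. A i)" using x assms(2) by simp
  then show ?thesis by (auto simp: small_def)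
qed

lemma small_powerset: "small A \<Longrightarrow> small {y. elts y \<subseteq> A}"
  using power by (metis small_def)

text \<open>Pairing comes from replacement on a set with exactly two members: the double power set
  of the empty set, with members \<open>z\<close> (empty) and \<open>p\<close> (the singleton of
  \<open>z\<close>).\<close>

lemma small_pair [simp]: "small {a, b}"
proof -
  obtain z where z: "elts z = {}" using small_empty unfolding small_def by blast
  obtain p where p: "elts p = {y. elts y \<subseteq> elts z}" using power by blast
  have "z \<in> elts p" using p by simp
  have zp: "z \<noteq> p" using \<open>z \<in> elts p\<close> z by auto
  define f where "f y = (if y = z then a else b)" for y
  have "small (f ` {y. elts y \<subseteq> elts p})" by (simp add: small_powerset)
  moreover have "f z = a" "f p = b" using zp by (auto simp: f_def)
  then have "f ` {y. elts y \<subseteq> elts p} = {a, b}"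
    using z by (auto simp: f_def image_iff split: if_splits)
  ultimately show ?thesis by simp
qed

lemma small_sing [simp]: "small {a}"
  using small_pair[of a a] by simp

lemma small_Un: "small A \<Longrightarrow> small B \<Longrightarrow> small (A \<union> B)"
  using small_Union[of "{mk A, mk B}" elts] by simp

lemma small_insert [simp]: "small A \<Longrightarrow> small (insert a A)"
  using small_Un[of "{a}" A] by simp

lemma mem_irrefl [simp]: "x \<notin> elts x"
  using wf_irrefl[OF foundation, of x] by simp

lemma mem_asym: "x \<in> elts y \<Longrightarrow> y \<notin> elts x"
  using wf_asym[OF foundation, of x y] by simp

lemma mem_induct [case_names step]:
  assumes "\<And>x. (\<And>y. y \<in> elts x \<Longrightarrow> P y) \<Longrightarrow> P x"
  shows "P x"
  by (rule wf_induct_rule[OF foundation, of P]) (rule assms, simp)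

lemma mem_minimal:
  assumes "x \<in> A"
  obtains m where "m \<in> A" "\<And>y. y \<in> elts m \<Longrightarrow> y \<notin> A"
  by (rule wfE_min[OF foundation assms]) (auto intro: that)

definition trans_class :: "'v set \<Rightarrow> bool" where
  "trans_class M \<longleftrightarrow> (\<forall>x\<in>M. elts x \<subseteq> M)"

lemma transitive_iff: "transitive x \<longleftrightarrow> trans_class (elts x)"
  by (simp add: transitive_def trans_class_def)

lemma trans_classD: "trans_class M \<Longrightarrow> x \<in> M \<Longrightarrow> y \<in> elts x \<Longrightarrow> y \<in> M"
  by (auto simp: trans_class_def)

lemma elts_subset_tc: "elts x \<subseteq> tc x"
  by (auto simp: tc_def)

lemma trans_class_tc: "trans_class (tc x)"
  unfolding trans_class_def tc_def by (auto intro: trancl_into_trancl2)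

lemma tc_least:
  assumes "trans_class M" "elts x \<subseteq> M"
  shows "tc x \<subseteq> M"
proof
  fix y assume "y \<in> tc x"
  then have "(y, x) \<in> {(y, x). y \<in> elts x}\<^sup>+" by (simp add: tc_def)
  then show "y \<in> M"
    by (induction rule: converse_trancl_induct) (use assms in \<open>auto simp: trans_class_def\<close>)
qed

lemma tc_mono: "y \<in> tc x \<Longrightarrow> tc y \<subseteq> tc x"
  by (meson tc_least trans_class_tc trans_class_def)

lemma trans_class_insert_tc: "trans_class (insert x (tc x))"
  using trans_class_tc[of x] elts_subset_tc[of x] by (auto simp: trans_class_def)

lemma trans_class_UN: "(\<And>i. i \<in> I \<Longrightarrow> trans_class (A i)) \<Longrightarrow> trans_class (\<Union>i\<in>I. A i)"
  by (fastforce simp: trans_class_def)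

lemma trans_class_Un: "trans_class A \<Longrightarrow> trans_class B \<Longrightarrow> trans_class (A \<union> B)"
  by (fastforce simp: trans_class_def)

lemma small_tc [simp]: "small (tc x)"
proof (induction x rule: mem_induct)
  case (step x)
  have "trans_class (\<Union>y\<in>elts x. insert y (tc y))"
    by (intro trans_class_UN trans_class_insert_tc)
  then have "tc x \<subseteq> (\<Union>y\<in>elts x. insert y (tc y))"
    by (rule tc_least) auto
  moreover have "small (\<Union>y\<in>elts x. insert y (tc y))"
    using step by (intro small_Union) auto
  ultimately show ?case by (rule small_subset[rotated])
qed

text \<open>The Mostowski recursion for a possibly non-extensional relation. Smallness of
  \<open>A\<close> makes each class of predecessors, hence each image, a set. Injectivity is proved
  separately where it is wanted.\<close>

lemma collapse_exists:
  assumes "wf E" "E \<subseteq> A \<times> A" "small A"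
  obtains \<pi> where "\<And>b. elts (\<pi> b) = \<pi> ` {a. (a, b) \<in> E}"
proof
  define \<pi> where "\<pi> = wfrec E (\<lambda>f b. mk (f ` {a. (a, b) \<in> E}))"
  fix b
  have sm: "small {a. (a, b) \<in> E}"
    by (rule small_subset[OF assms(3)]) (use assms(2) in auto)
  have "\<pi> b = mk (cut \<pi> E b ` {a. (a, b) \<in> E})"
    unfolding \<pi>_def by (subst wfrec[OF assms(1)]) simp
  also have "cut \<pi> E b ` {a. (a, b) \<in> E} = \<pi> ` {a. (a, b) \<in> E}"
    by (auto simp: cut_def)
  finally show "elts (\<pi> b) = \<pi> ` {a. (a, b) \<in> E}"
    using sm by simp
qed

end

subsection \<open>Ordinals and the cumulative hierarchy\<close>

context zfc_universe
begin

lemma ordinal_mem: "ordinal \<alpha> \<Longrightarrow> \<beta> \<in> elts \<alpha> \<Longrightarrow> ordinal \<beta>"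
  unfolding ordinal_def transitive_def[of \<alpha>] by blast

lemma ordinal_mem_subset: "ordinal \<alpha> \<Longrightarrow> \<beta> \<in> elts \<alpha> \<Longrightarrow> elts \<beta> \<subseteq> elts \<alpha>"
  by (auto simp: ordinal_def transitive_def)

lemma ordinal_mem_trans: "ordinal \<alpha> \<Longrightarrow> \<beta> \<in> elts \<alpha> \<Longrightarrow> \<gamma> \<in> elts \<beta> \<Longrightarrow> \<gamma> \<in> elts \<alpha>"
  using ordinal_mem_subset by auto

lemma ordinal_linear:
  assumes "ordinal \<alpha>" "ordinal \<beta>"
  shows "\<alpha> \<in> elts \<beta> \<or> \<alpha> = \<beta> \<or> \<beta> \<in> elts \<alpha>"
  using assms
proof (induction \<alpha> arbitrary: \<beta> rule: mem_induct)
  case (step \<alpha>)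
  note outer = step
  from \<open>ordinal \<beta>\<close> show ?case
  proof (induction \<beta> rule: mem_induct)
    case (step \<beta>)
    show ?case
    proof (rule ccontr)
      assume neg: "\<not> ?thesis"
      have "x \<in> elts \<beta>" if "x \<in> elts \<alpha>" for x
        using outer(1)[OF that ordinal_mem[OF outer(2) that] step(2)]
          ordinal_mem_trans[OF outer(2) that] that neg by auto
      moreover have "y \<in> elts \<alpha>" if "y \<in> elts \<beta>" for y
        using step(1)[OF that ordinal_mem[OF step(2) that]]
          ordinal_mem_trans[OF step(2) that] that neg by auto
      ultimately have "elts \<alpha> = elts \<beta>" by auto
      then show False using neg extensionality by simp
    qed
  qed
qed

lemma ordinal_mkI:
  assumes "small A" "trans_class A" "\<And>x. x \<in> A \<Longrightarrow> ordinal x"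
  shows "ordinal (mk A)"
  using assms by (simp add: ordinal_def transitive_iff)

text \<open>Collapse the strict part of a well-order of \<open>A\<close>. Transitivity of the order
  makes the values ordinals, and totality makes the collapse injective, since of two distinct points
  one value is a member of the other.\<close>

lemma exists_ordinal_eqpoll:
  assumes "small A"
  obtains \<alpha> where "ordinal \<alpha>" "elts \<alpha> \<approx> A"
proof -
  obtain r where r: "well_order_on A r" using well_order_on by blast
  define E where "E = r - Id"
  have wfE: "wf E" using r by (simp add: E_def well_order_on_def)
  have lin: "linear_order_on A r" using r by (simp add: well_order_on_def)
  have EA: "E \<subseteq> A \<times> A"
    using lin by (auto simp: E_def linear_order_on_def partial_order_on_def preorder_on_def refl_on_def)
  have trE: "(a, c) \<in> E" if "(a, b) \<in> E" "(b, c) \<in> E" for a b c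
    using lin that unfolding E_def linear_order_on_def partial_order_on_def preorder_on_def
    by (auto dest: transD antisymD)
  have totE: "(a, b) \<in> E \<or> (b, a) \<in> E" if "a \<in> A" "b \<in> A" "a \<noteq> b" for a b
    using lin that by (auto simp: E_def linear_order_on_def total_on_def)
  obtain \<pi> where \<pi>: "\<And>b. elts (\<pi> b) = \<pi> ` {a. (a, b) \<in> E}"
    by (rule collapse_exists[OF wfE EA assms]) (auto intro: that)
  have trans: "trans_class (elts (\<pi> b))" for b
    unfolding trans_class_def \<pi> by (auto simp: \<pi> dest: trE)
  have ord: "ordinal (\<pi> b)" for b
    using trans \<pi>[of b] unfolding ordinal_def transitive_iff by (metis imageE)
  have inj: "inj_on \<pi> A"
  proof (rule inj_onI, rule ccontr)
    fix a b assume "a \<in> A" "b \<in> A" "\<pi> a = \<pi> b" "a \<noteq> b"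
    then have "\<pi> a \<in> elts (\<pi> b) \<or> \<pi> b \<in> elts (\<pi> a)"
      using totE \<pi> by blast
    then show False using \<open>\<pi> a = \<pi> b\<close> by simp
  qed
  show ?thesis
  proof
    have "trans_class (\<pi> ` A)"
      using EA by (auto simp: trans_class_def \<pi>)
    then show "ordinal (mk (\<pi> ` A))"
      using assms ord by (intro ordinal_mkI) auto
    show "elts (mk (\<pi> ` A)) \<approx> A"
      using assms inj by (simp add: inj_on_image_eqpoll_self)
  qed
qed

text \<open>The ordinal equipollent to \<open>A\<close> must lie below \<mu>: otherwise linearity
  makes \<mu> a subset of it, and \<mu> would inject into \<open>A\<close>.\<close>

lemma lesspoll_ordinal:
  fixes A :: "'v set"
  assumes "ordinal \<mu>" "A \<prec> elts \<mu>"
  obtains \<beta> where "\<beta> \<in> elts \<mu>" "A \<approx> elts \<beta>"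
proof -
  have "small A"
    using assms(2) lesspoll_imp_lepoll small_lepoll small_elts by blast
  then obtain \<beta> where \<beta>: "ordinal \<beta>" "elts \<beta> \<approx> A"
    by (rule exists_ordinal_eqpoll)
  have "\<not> elts \<mu> \<lesssim> elts \<beta>"
    using assms(2) \<beta>(2) by (meson lepoll_trans2 lepoll_antisym lesspoll_def)
  then have "\<beta> \<in> elts \<mu>"
    using ordinal_linear[OF \<beta>(1) assms(1)] ordinal_mem_subset[OF \<beta>(1), of \<mu>]
    by (auto dest: subset_imp_lepoll)
  then show ?thesis using that \<beta>(2) eqpoll_sym by blast
qed

lemma cardinal_mem_lesspoll:
  assumes "cardinal \<kappa>" "\<alpha> \<in> elts \<kappa>"
  shows "elts \<alpha> \<prec> elts \<kappa>"
  using assms ordinal_mem_subset[of \<kappa> \<alpha>]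
  by (auto simp: cardinal_def lesspoll_def intro: subset_imp_lepoll)

text \<open>The description is identified with the least ordinal that does not inject into \<kappa>.
  Such ordinals exist by Cantor's theorem applied to the power set of \<kappa>.\<close>

lemma card_succ:
  assumes "cardinal \<kappa>"
  shows "ordinal (card_succ \<kappa>)" "\<kappa> \<in> elts (card_succ \<kappa>)" "\<not> elts (card_succ \<kappa>) \<lesssim> elts \<kappa>"
    "\<And>\<alpha>. \<alpha> \<in> elts (card_succ \<kappa>) \<Longrightarrow> elts \<alpha> \<lesssim> elts \<kappa>"
proof -
  have \<kappa>: "ordinal \<kappa>" using assms by (simp add: cardinal_def)
  define P where "P = {\<alpha>. ordinal \<alpha> \<and> \<not> elts \<alpha> \<lesssim> elts \<kappa>}"
  have "inj_on elts {y. elts y \<subseteq> elts \<kappa>}"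
    by (auto intro: inj_onI extensionality)
  moreover have "elts ` {y. elts y \<subseteq> elts \<kappa>} = Pow (elts \<kappa>)"
  proof -
    have "B \<in> elts ` {y. elts y \<subseteq> elts \<kappa>}" if "B \<subseteq> elts \<kappa>" for B
      using that small_subset[OF small_elts that] by (intro image_eqI[of _ _ "mk B"]) auto
    then show ?thesis by auto
  qed
  ultimately have pw: "{y. elts y \<subseteq> elts \<kappa>} \<approx> Pow (elts \<kappa>)"
    using inj_on_image_eqpoll_self eqpoll_sym by metis
  obtain \<pi> where \<pi>: "ordinal \<pi>" "elts \<pi> \<approx> {y. elts y \<subseteq> elts \<kappa>}"
    using exists_ordinal_eqpoll[OF small_powerset[OF small_elts]] .
  have "\<not> elts \<pi> \<lesssim> elts \<kappa>"
  proof
    assume "elts \<pi> \<lesssim> elts \<kappa>"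
    moreover have "Pow (elts \<kappa>) \<approx> elts \<pi>" using pw \<pi>(2) eqpoll_trans eqpoll_sym by metis
    ultimately have "Pow (elts \<kappa>) \<lesssim> elts \<kappa>" by (rule lepoll_trans1[rotated])
    then show False using lesspoll_Pow_self lesspoll_trans1 lesspoll_not_refl by metis
  qed
  then have "\<pi> \<in> P" using \<pi> by (simp add: P_def)
  then obtain \<mu> where \<mu>: "\<mu> \<in> P" and min: "\<And>y. y \<in> elts \<mu> \<Longrightarrow> y \<notin> P"
    by (rule mem_minimal) (auto intro: that)
  have o\<mu>: "ordinal \<mu>" and nle: "\<not> elts \<mu> \<lesssim> elts \<kappa>" using \<mu> by (auto simp: P_def)
  have le: "elts \<alpha> \<lesssim> elts \<kappa>" if "\<alpha> \<in> elts \<mu>" for \<alpha>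
    using min[OF that] ordinal_mem[OF o\<mu> that] by (simp add: P_def)
  have "cardinal \<mu>"
    unfolding cardinal_def
  proof (intro conjI ballI notI)
    fix \<alpha> assume "\<alpha> \<in> elts \<mu>" "elts \<alpha> \<approx> elts \<mu>"
    then show False using le nle eqpoll_sym lepoll_trans1 by metis
  qed (rule o\<mu>)
  moreover have "\<kappa> \<in> elts \<mu>"
    using ordinal_linear[OF \<kappa> o\<mu>] nle subset_imp_lepoll[OF ordinal_mem_subset[OF \<kappa>, of \<mu>]] by auto
  moreover have "elts \<mu> \<subseteq> elts \<nu>" if "cardinal \<nu> \<and> \<kappa> \<in> elts \<nu>" for \<nu>
  proof -
    have "\<nu> \<notin> elts \<mu>"
    proof
      assume "\<nu> \<in> elts \<mu>"
      then have "elts \<nu> \<lesssim> elts \<kappa>" by (rule le)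
      then show False
        using cardinal_mem_lesspoll[of \<nu> \<kappa>] that lesspoll_trans1 lesspoll_not_refl by metis
    qed
    then show ?thesis
      using that ordinal_linear[OF o\<mu>, of \<nu>] ordinal_mem_subset[of \<nu> \<mu>] by (auto simp: cardinal_def)
  qed
  ultimately have "card_succ \<kappa> = \<mu>"
    unfolding card_succ_def by (intro the_equality) (auto intro!: extensionality)
  then show "ordinal (card_succ \<kappa>)" "\<kappa> \<in> elts (card_succ \<kappa>)" "\<not> elts (card_succ \<kappa>) \<lesssim> elts \<kappa>"
    "\<And>\<alpha>. \<alpha> \<in> elts (card_succ \<kappa>) \<Longrightarrow> elts \<alpha> \<lesssim> elts \<kappa>"
    using o\<mu> \<open>\<kappa> \<in> elts \<mu>\<close> nle le by auto
qed

lemma H_card_succ: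
  assumes "cardinal \<kappa>"
  shows "H (card_succ \<kappa>) = {x. tc x \<lesssim> elts \<kappa>}"
proof -
  note s = card_succ[OF assms]
  have "A \<prec> elts (card_succ \<kappa>) \<longleftrightarrow> A \<lesssim> elts \<kappa>" for A :: "'v set"
  proof
    assume "A \<prec> elts (card_succ \<kappa>)"
    then obtain \<beta> where "\<beta> \<in> elts (card_succ \<kappa>)" "A \<approx> elts \<beta>"
      by (rule lesspoll_ordinal[OF s(1)])
    then show "A \<lesssim> elts \<kappa>" using s(4) lepoll_trans1 by blast
  next
    assume A: "A \<lesssim> elts \<kappa>"
    have "elts \<kappa> \<lesssim> elts (card_succ \<kappa>)"
      using ordinal_mem_subset[OF s(1,2)] by (rule subset_imp_lepoll)
    then have "elts \<kappa> \<prec> elts (card_succ \<kappa>)"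
      using s(3) eqpoll_sym eqpoll_imp_lepoll unfolding lesspoll_def by metis
    then show "A \<prec> elts (card_succ \<kappa>)" using A lesspoll_trans1 by blast
  qed
  then show ?thesis by (simp add: H_def)
qed

section \<open>The cumulative hierarchy\<close>

lemma V_iff: "x \<in> V \<alpha> \<longleftrightarrow> (\<exists>\<beta>\<in>elts \<alpha>. elts x \<subseteq> V \<beta>)"
  by (subst V.simps) auto

lemma trans_class_V: "trans_class (V \<alpha>)"
proof (induction \<alpha> rule: mem_induct)
  case (step \<alpha>)
  show ?case
    unfolding trans_class_def
  proof (intro ballI subsetI)
    fix x y assume "x \<in> V \<alpha>" "y \<in> elts x"
    then obtain \<beta> where \<beta>: "\<beta> \<in> elts \<alpha>" "y \<in> V \<beta>" by (auto simp: V_iff[of x])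
    then have "elts y \<subseteq> V \<beta>" using step by (auto simp: trans_class_def)
    then show "y \<in> V \<alpha>" using \<beta> by (auto simp: V_iff[of y])
  qed
qed

lemma V_mono_mem: "\<beta> \<in> elts \<alpha> \<Longrightarrow> V \<beta> \<subseteq> V \<alpha>"
  using trans_class_V[of \<beta>] unfolding subset_iff V_iff[of _ \<alpha>] trans_class_def by blast

lemma small_V [simp]: "small (V \<alpha>)"
proof (induction \<alpha> rule: mem_induct)
  case (step \<alpha>)
  then show ?case
    by (subst V.simps) (intro small_Union small_powerset small_elts)
qed

lemma ordinal_subset_V: "ordinal \<alpha> \<Longrightarrow> elts \<alpha> \<subseteq> V \<alpha>"
proof (induction \<alpha> rule: mem_induct)
  case (step \<alpha>)
  then show ?case
    using ordinal_mem[OF step(2)] unfolding subset_iff V_iff[of _ \<alpha>] by blast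
qed

lemma not_mem_V_self: "\<alpha> \<notin> V \<alpha>"
proof (induction \<alpha> rule: mem_induct)
  case (step \<alpha>)
  then show ?case by (auto simp: V_iff[of \<alpha> \<alpha>])
qed

text \<open>The recursion for \<open>V\<close> accepts every set as index, and an arbitrary index
  can be replaced by its rank: the supremum of the successors of the ranks \<open>r y\<close> of its
  members, which is \<open>mk A\<close> below.\<close>

lemma exists_rank: "\<exists>\<alpha>. ordinal \<alpha> \<and> V \<alpha> = V x"
proof (induction x rule: mem_induct)
  case (step x)
  then obtain r where r: "\<And>y. y \<in> elts x \<Longrightarrow> ordinal (r y) \<and> V (r y) = V y" by metis
  define A where "A = (\<Union>y\<in>elts x. insert (r y) (elts (r y)))"
  have sA: "small A" unfolding A_def by (intro small_Union) auto
  have "trans_class A"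
    using r unfolding A_def by (fastforce simp: trans_class_def dest: ordinal_mem_trans)
  moreover have "ordinal a" if "a \<in> A" for a
    using that r ordinal_mem unfolding A_def by auto
  ultimately have "ordinal (mk A)" using sA by (intro ordinal_mkI)
  moreover have "V (mk A) = V x"
  proof (intro equalityI subsetI)
    fix z assume "z \<in> V (mk A)"
    then obtain a y where "y \<in> elts x" "a = r y \<or> a \<in> elts (r y)" "elts z \<subseteq> V a"
      unfolding V_iff[of z "mk A"] elts_mk[OF sA] unfolding A_def by blast
    then have "elts z \<subseteq> V y" using r V_mono_mem[of a "r y"] by auto
    then show "z \<in> V x" using \<open>y \<in> elts x\<close> by (auto simp: V_iff[of z])
  next
    fix z assume "z \<in> V x"
    then obtain y where "y \<in> elts x" "elts z \<subseteq> V (r y)" using r by (auto simp: V_iff[of z])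
    then show "z \<in> V (mk A)"
      unfolding V_iff[of z "mk A"] elts_mk[OF sA] unfolding A_def by blast
  qed
  ultimately show ?case by blast
qed

end

section \<open>Inaccessible cardinals and sizes in the hierarchy below them\<close>

locale inaccessible_cardinal = zfc_universe elts for elts :: "'v \<Rightarrow> 'v set" +
  fixes \<kappa> :: 'v
  assumes inacc: "inaccessible \<kappa>"
begin

lemma card_\<kappa>: "cardinal \<kappa>" and ord_\<kappa>: "ordinal \<kappa>" and inf_\<kappa>: "infinite (elts \<kappa>)"
  and uncountable_\<kappa>: "uncountable (elts \<kappa>)"
  using inacc by (auto simp: inaccessible_def regular_def cardinal_def)

lemma countable_lesspoll_\<kappa>: "countable A \<Longrightarrow> A \<prec> elts \<kappa>"
  using countable_lepoll_infinite[OF _ inf_\<kappa>] uncountable_\<kappa> countable_eqpoll eqpoll_sym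
  unfolding lesspoll_def by metis

text \<open>Regularity in the form used later. Failure of unboundedness is stated with inclusion;
  linearity of the ordinals turns it into a bound by membership.\<close>

lemma bounded_subset:
  assumes "B \<subseteq> elts \<kappa>" "B \<prec> elts \<kappa>"
  obtains \<beta> where "\<beta> \<in> elts \<kappa>" "B \<subseteq> elts \<beta>"
proof -
  have "\<not> unbounded_in B \<kappa>" using assms(2) inacc by (auto simp: inaccessible_def regular_def)
  then obtain \<beta> where \<beta>: "\<beta> \<in> elts \<kappa>" "\<And>\<alpha>. \<alpha> \<in> B \<Longrightarrow> \<not> elts \<beta> \<subseteq> elts \<alpha>"
    using assms(1) by (auto simp: unbounded_in_def)
  have "\<alpha> \<in> elts \<beta>" if "\<alpha> \<in> B" for \<alpha>
    using \<beta>(2)[OF that] ordinal_linear[of \<alpha> \<beta>] ordinal_mem_subset[of \<alpha> \<beta>]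
      ordinal_mem[OF ord_\<kappa>] \<beta>(1) that assms(1) by blast
  then show ?thesis using that \<beta>(1) by blast
qed

lemma V_\<kappa>_bounded_subset:
  assumes "A \<subseteq> V \<kappa>" "A \<prec> elts \<kappa>"
  obtains \<beta> where "\<beta> \<in> elts \<kappa>" "A \<subseteq> V \<beta>"
proof -
  obtain f where f: "\<And>x. x \<in> A \<Longrightarrow> f x \<in> elts \<kappa> \<and> elts x \<subseteq> V (f x)"
    using assms(1) unfolding subset_iff V_iff[of _ \<kappa>] by metis
  have "f ` A \<prec> elts \<kappa>" using image_lepoll assms(2) by (rule lesspoll_trans1)
  then obtain \<beta> where \<beta>: "\<beta> \<in> elts \<kappa>" "f ` A \<subseteq> elts \<beta>"
    using f bounded_subset[of "f ` A"] by blast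
  then have "A \<subseteq> V \<beta>" using f unfolding subset_iff V_iff[of _ \<beta>] by blast
  then show ?thesis using that \<beta>(1) by blast
qed

lemma mk_mem_V_\<kappa>:
  assumes "A \<subseteq> V \<kappa>" "A \<prec> elts \<kappa>"
  shows "mk A \<in> V \<kappa>"
proof -
  have "small A" using assms(1) by (rule small_subset[OF small_V])
  then show ?thesis using V_\<kappa>_bounded_subset[OF assms] by (metis V_iff elts_mk)
qed

lemma exists_infinite_bound:
  fixes A B :: "'v set"
  assumes "A \<prec> elts \<kappa>" "B \<prec> elts \<kappa>"
  obtains \<theta> where "\<theta> \<in> elts \<kappa>" "infinite (elts \<theta>)" "A \<lesssim> elts \<theta>" "B \<lesssim> elts \<theta>"
proof -
  obtain \<alpha> where \<alpha>: "\<alpha> \<in> elts \<kappa>" "A \<approx> elts \<alpha>" using assms(1) by (rule lesspoll_ordinal[OF ord_\<kappa>])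
  obtain \<beta> where \<beta>: "\<beta> \<in> elts \<kappa>" "B \<approx> elts \<beta>" using assms(2) by (rule lesspoll_ordinal[OF ord_\<kappa>])
  \<comment> \<open>\<open>C\<close> is there to make the bound infinite: \<kappa> is regular and
    uncountable, so \<open>C\<close> is contained in some member of \<kappa>.\<close>
  obtain C where C: "C \<subseteq> elts \<kappa>" "countable C" "infinite C"
    using infinite_countable_subset'[OF inf_\<kappa>] by blast
  obtain \<gamma> where \<gamma>: "\<gamma> \<in> elts \<kappa>" "C \<subseteq> elts \<gamma>"
    using bounded_subset[OF C(1) countable_lesspoll_\<kappa>[OF C(2)]] .
  obtain \<theta> where \<theta>: "\<theta> \<in> elts \<kappa>" "{\<alpha>, \<beta>, \<gamma>} \<subseteq> elts \<theta>"
    using bounded_subset[of "{\<alpha>, \<beta>, \<gamma>}"] countable_lesspoll_\<kappa>[of "{\<alpha>, \<beta>, \<gamma>}"] \<alpha> \<beta> \<gamma> by auto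
  have o: "ordinal \<theta>" using ordinal_mem[OF ord_\<kappa> \<theta>(1)] .
  have sub: "elts \<alpha> \<subseteq> elts \<theta>" "elts \<beta> \<subseteq> elts \<theta>" "elts \<gamma> \<subseteq> elts \<theta>"
    using \<theta>(2) ordinal_mem_subset[OF o] by auto
  show ?thesis
  proof
    show "infinite (elts \<theta>)" using C(3) \<gamma>(2) sub(3) by (meson finite_subset)
    show "A \<lesssim> elts \<theta>" "B \<lesssim> elts \<theta>"
      using \<alpha>(2) \<beta>(2) sub by (meson lepoll_trans1 subset_imp_lepoll)+
  qed (rule \<theta>(1))
qed

text \<open>By regularity the sizes of all \<open>A i\<close> are bounded by one \<delta> below
  \<kappa>. An infinite \<theta> below \<kappa> then bounds the index set and every
  \<open>A i\<close>, so it bounds the union.\<close>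

lemma UN_lesspoll_\<kappa>:
  fixes I :: "'v set" and A :: "'v \<Rightarrow> 'v set"
  assumes "I \<prec> elts \<kappa>" "\<And>i. i \<in> I \<Longrightarrow> A i \<prec> elts \<kappa>"
  shows "(\<Union>i\<in>I. A i) \<prec> elts \<kappa>"
proof -
  have "\<exists>\<alpha>. \<alpha> \<in> elts \<kappa> \<and> A i \<lesssim> elts \<alpha>" if "i \<in> I" for i
    using lesspoll_ordinal[OF ord_\<kappa> assms(2)[OF that]] eqpoll_imp_lepoll by metis
  then obtain f where f: "\<And>i. i \<in> I \<Longrightarrow> f i \<in> elts \<kappa> \<and> A i \<lesssim> elts (f i)" by metis
  have "f ` I \<prec> elts \<kappa>" using image_lepoll assms(1) by (rule lesspoll_trans1)
  then obtain \<delta> where \<delta>: "\<delta> \<in> elts \<kappa>" "f ` I \<subseteq> elts \<delta>"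
    using f bounded_subset[of "f ` I"] by blast
  obtain \<theta> where \<theta>: "\<theta> \<in> elts \<kappa>" "infinite (elts \<theta>)" "I \<lesssim> elts \<theta>" "elts \<delta> \<lesssim> elts \<theta>"
    using exists_infinite_bound[OF assms(1) cardinal_mem_lesspoll[OF card_\<kappa> \<delta>(1)]] .
  have "A i \<lesssim> elts \<theta>" if "i \<in> I" for i
  proof -
    have "elts (f i) \<subseteq> elts \<delta>"
      using \<delta> that ordinal_mem_subset[OF ordinal_mem[OF ord_\<kappa> \<delta>(1)]] by blast
    then show ?thesis
      using f[OF that] \<theta>(4) by (meson lepoll_trans subset_imp_lepoll)
  qed
  then have "(\<Union>i\<in>I. A i) \<lesssim> elts \<theta>"
    by (intro lepoll_UN_infinite \<theta>(2,3))
  then show ?thesis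
    using cardinal_mem_lesspoll[OF card_\<kappa> \<theta>(1)] lesspoll_trans1 by blast
qed

text \<open>The strong limit property handles the power set at each level, and regularity the union
  over the earlier levels.\<close>

lemma V_lesspoll_\<kappa>: "\<beta> \<in> elts \<kappa> \<Longrightarrow> V \<beta> \<prec> elts \<kappa>"
proof (induction \<beta> rule: mem_induct)
  case (step \<beta>)
  have "{x. elts x \<subseteq> V \<gamma>} \<prec> elts \<kappa>" if \<gamma>: "\<gamma> \<in> elts \<beta>" for \<gamma>
  proof -
    have "V \<gamma> \<prec> elts \<kappa>" using step \<gamma> ordinal_mem_trans[OF ord_\<kappa>] by blast
    then obtain \<alpha> where \<alpha>: "\<alpha> \<in> elts \<kappa>" "V \<gamma> \<approx> elts \<alpha>"
      by (rule lesspoll_ordinal[OF ord_\<kappa>])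
    obtain f where f: "inj_on f (V \<gamma>)" "f ` V \<gamma> \<subseteq> elts \<alpha>"
      using eqpoll_imp_lepoll[OF \<alpha>(2)] unfolding lepoll_def by (elim exE conjE)
    have "inj_on (\<lambda>x. f ` elts x) {x. elts x \<subseteq> V \<gamma>}"
    proof (rule inj_onI)
      fix x y assume "x \<in> {x. elts x \<subseteq> V \<gamma>}" "y \<in> {x. elts x \<subseteq> V \<gamma>}" "f ` elts x = f ` elts y"
      then have "elts x = elts y" using inj_on_image_eq_iff[OF f(1)] by auto
      then show "x = y" by (rule extensionality)
    qed
    moreover have "(\<lambda>x. f ` elts x) ` {x. elts x \<subseteq> V \<gamma>} \<subseteq> Pow (elts \<alpha>)"
      using f(2) by auto
    ultimately have "{x. elts x \<subseteq> V \<gamma>} \<lesssim> Pow (elts \<alpha>)"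
      unfolding lepoll_def by (intro exI conjI)
    then show ?thesis
      using inacc \<alpha>(1) lesspoll_trans1 by (auto simp: inaccessible_def strong_limit_def)
  qed
  then show ?case
    using UN_lesspoll_\<kappa>[OF cardinal_mem_lesspoll[OF card_\<kappa> step(2)], of "\<lambda>\<gamma>. {x. elts x \<subseteq> V \<gamma>}"]
    by (subst V.simps) blast
qed

lemma V_\<kappa>_iff: "x \<in> V \<kappa> \<longleftrightarrow> elts x \<subseteq> V \<kappa> \<and> elts x \<prec> elts \<kappa>"
proof
  assume x: "x \<in> V \<kappa>"
  then obtain \<beta> where "\<beta> \<in> elts \<kappa>" "elts x \<subseteq> V \<beta>" by (auto simp: V_iff[of x])
  then have "elts x \<prec> elts \<kappa>"
    using V_lesspoll_\<kappa> lesspoll_trans1 subset_imp_lepoll by blast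
  then show "elts x \<subseteq> V \<kappa> \<and> elts x \<prec> elts \<kappa>"
    using x trans_class_V[of \<kappa>] by (auto simp: trans_class_def)
next
  assume "elts x \<subseteq> V \<kappa> \<and> elts x \<prec> elts \<kappa>"
  then show "x \<in> V \<kappa>" using mk_mem_V_\<kappa>[of "elts x"] by simp
qed

text \<open>This identifies the small structure of the elementarity statement with the one in which
  reflection is formulated.\<close>

lemma H_\<kappa>_eq_V: "H \<kappa> = V \<kappa>"
proof (intro equalityI subsetI)
  fix x assume "x \<in> H \<kappa>"
  then have "tc x \<prec> elts \<kappa>" by (simp add: H_def)
  then show "x \<in> V \<kappa>"
  proof (induction x rule: mem_induct)
    case (step x)
    have "y \<in> V \<kappa>" if "y \<in> elts x" for y
    proof -
      have "tc y \<subseteq> tc x" using that elts_subset_tc tc_mono by blast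
      then show ?thesis
        using step that subset_imp_lepoll lesspoll_trans1 by metis
    qed
    moreover have "elts x \<prec> elts \<kappa>"
      using step(2) elts_subset_tc subset_imp_lepoll lesspoll_trans1 by metis
    ultimately show ?case by (auto simp: V_\<kappa>_iff[of x])
  qed
next
  fix x assume "x \<in> V \<kappa>"
  then obtain \<beta> where "\<beta> \<in> elts \<kappa>" "elts x \<subseteq> V \<beta>" by (auto simp: V_iff[of x])
  moreover then have "tc x \<subseteq> V \<beta>" by (intro tc_least trans_class_V)
  ultimately have "tc x \<prec> elts \<kappa>"
    using V_lesspoll_\<kappa> lesspoll_trans1 subset_imp_lepoll by blast
  then show "x \<in> H \<kappa>" by (simp add: H_def)
qed

text \<open>Together with \<open>\<kappa>_lepoll_V\<close> this says that \<open>V \<kappa>\<close>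
  has size \<kappa>, which is why sets with transitive closure of size at most \<kappa> can be coded
  by relations on \<open>V \<kappa>\<close>.\<close>

lemma V_\<kappa>_lepoll: "V \<kappa> \<lesssim> elts \<kappa>"
proof -
  have "V \<kappa> = (\<Union>\<beta>\<in>elts \<kappa>. V \<beta>)"
  proof (intro equalityI subsetI)
    fix x assume "x \<in> V \<kappa>"
    then obtain \<beta> where "\<beta> \<in> elts \<kappa>" "{x} \<subseteq> V \<beta>"
      using V_\<kappa>_bounded_subset[of "{x}"] countable_lesspoll_\<kappa>[of "{x}"] by auto
    then show "x \<in> (\<Union>\<beta>\<in>elts \<kappa>. V \<beta>)" by auto
  qed (use V_mono_mem in blast)
  also have "\<dots> \<lesssim> elts \<kappa>"
    by (intro lepoll_UN_infinite inf_\<kappa> lepoll_refl lesspoll_imp_lepoll V_lesspoll_\<kappa>)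
  finally show ?thesis .
qed

lemma \<kappa>_lepoll_V: "elts \<kappa> \<lesssim> V \<kappa>"
  by (rule subset_imp_lepoll[OF ordinal_subset_V[OF ord_\<kappa>]])

lemma infinite_V_\<kappa>: "infinite (V \<kappa>)"
  using ordinal_subset_V[OF ord_\<kappa>] inf_\<kappa> finite_subset by blast

end

subsection \<open>Formulas\<close>

instance fm :: countable
  by countable_datatype

text \<open>Bound variables are counted too, so variables from \<open>n\<close> on are fresh for
  \<phi> and cannot be captured by its quantifiers.\<close>

primrec vars_below :: "nat \<Rightarrow> fm \<Rightarrow> bool" where
  "vars_below n (Mem i j) \<longleftrightarrow> i < n \<and> j < n"
| "vars_below n (Eq i j) \<longleftrightarrow> i < n \<and> j < n"
| "vars_below n (InX i) \<longleftrightarrow> i < n"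
| "vars_below n (InY i) \<longleftrightarrow> i < n"
| "vars_below n (Neg \<phi>) \<longleftrightarrow> vars_below n \<phi>"
| "vars_below n (And \<phi> \<psi>) \<longleftrightarrow> vars_below n \<phi> \<and> vars_below n \<psi>"
| "vars_below n (Forall i \<phi>) \<longleftrightarrow> i < n \<and> vars_below n \<phi>"

lemma vars_below_mono: "vars_below m \<phi> \<Longrightarrow> m \<le> n \<Longrightarrow> vars_below n \<phi>"
  by (induction \<phi>) auto

lemma exists_vars_below: "\<exists>n\<ge>m. vars_below n \<phi>"
proof (induction \<phi> arbitrary: m)
  case (And \<phi> \<psi>)
  then obtain k where "k \<ge> m" "vars_below k \<phi>" by blast
  moreover obtain l where "l \<ge> k" "vars_below l \<psi>" using And by blast
  ultimately show ?case using vars_below_mono by (intro exI[of _ l]) auto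
next
  case (Mem i j)
  show ?case by (rule exI[of _ "Suc (max m (max i j))"]) auto
next
  case (Eq i j)
  show ?case by (rule exI[of _ "Suc (max m (max i j))"]) auto
next
  case (InX i)
  show ?case by (rule exI[of _ "Suc (max m i)"]) auto
next
  case (InY i)
  show ?case by (rule exI[of _ "Suc (max m i)"]) auto
next
  case (Forall i \<phi>)
  then obtain k where "k \<ge> Suc (max m i)" "vars_below k \<phi>" by blast
  then show ?case by (intro exI[of _ k]) auto
qed auto

definition Iff :: "fm \<Rightarrow> fm \<Rightarrow> fm" where
  "Iff \<phi> \<psi> = And (Imp \<phi> \<psi>) (Imp \<psi> \<phi>)"

definition BAll :: "nat \<Rightarrow> nat \<Rightarrow> fm \<Rightarrow> fm" where
  "BAll i j \<phi> = Forall i (Imp (Mem i j) \<phi>)"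

definition BEx :: "nat \<Rightarrow> nat \<Rightarrow> fm \<Rightarrow> fm" where
  "BEx i j \<phi> = Neg (BAll i j (Neg \<phi>))"

lemma Delta0_Imp: "\<phi> \<in> Delta0 \<Longrightarrow> \<psi> \<in> Delta0 \<Longrightarrow> Imp \<phi> \<psi> \<in> Delta0"
  unfolding Imp_def by (intro Delta0.intros)

lemma Delta0_Iff: "\<phi> \<in> Delta0 \<Longrightarrow> \<psi> \<in> Delta0 \<Longrightarrow> Iff \<phi> \<psi> \<in> Delta0"
  unfolding Iff_def by (intro Delta0.intros Delta0_Imp)

lemma Delta0_BAll: "\<phi> \<in> Delta0 \<Longrightarrow> i \<noteq> j \<Longrightarrow> BAll i j \<phi> \<in> Delta0"
  unfolding BAll_def by (intro Delta0.intros)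

lemma Delta0_BEx: "\<phi> \<in> Delta0 \<Longrightarrow> i \<noteq> j \<Longrightarrow> BEx i j \<phi> \<in> Delta0"
  unfolding BEx_def by (intro Delta0.intros Delta0_BAll)

lemmas Delta0_intros = Delta0.intros(1-4) Delta0_Imp Delta0_Iff Delta0_BAll Delta0_BEx

section \<open>Satisfaction, absoluteness and quantifier blocks\<close>

context zfc_universe
begin

lemma sat_cong:
  assumes "vars_below n \<phi>" "\<And>i. i < n \<Longrightarrow> e i = e' i"
  shows "sat M X Y e \<phi> \<longleftrightarrow> sat M X Y e' \<phi>"
  using assms
proof (induction \<phi> arbitrary: e e')
  case (Forall i \<phi>)
  have "sat M X Y (e(i := a)) \<phi> \<longleftrightarrow> sat M X Y (e'(i := a)) \<phi>" for a
    by (rule Forall.IH) (use Forall.prems in auto)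
  then show ?case by simp
next
  case (Neg \<phi>)
  from Neg.IH[OF _ Neg.prems(2)] Neg.prems(1) show ?case by simp
next
  case (And \<phi> \<psi>)
  from And.IH[OF _ And.prems(2)] And.prems(1) show ?case by simp
qed auto

lemma sat_Imp [simp]: "sat M X Y e (Imp \<phi> \<psi>) \<longleftrightarrow> (sat M X Y e \<phi> \<longrightarrow> sat M X Y e \<psi>)"
  by (simp add: Imp_def)

lemma sat_Iff [simp]: "sat M X Y e (Iff \<phi> \<psi>) \<longleftrightarrow> (sat M X Y e \<phi> \<longleftrightarrow> sat M X Y e \<psi>)"
  by (auto simp: Iff_def)

lemma sat_Exists [simp]: "sat M X Y e (Exists i \<phi>) \<longleftrightarrow> (\<exists>a\<in>M. sat M X Y (e(i := a)) \<phi>)"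
  by (simp add: Exists_def)

abbreviation true :: "(nat \<Rightarrow> 'v) \<Rightarrow> fm \<Rightarrow> bool" where
  "true e \<phi> \<equiv> sat UNIV {} {} e \<phi>"

lemma true_BAll [simp]: "i \<noteq> j \<Longrightarrow> true e (BAll i j \<phi>) \<longleftrightarrow> (\<forall>a\<in>elts (e j). true (e(i := a)) \<phi>)"
  by (auto simp: BAll_def)

lemma true_BEx [simp]: "i \<noteq> j \<Longrightarrow> true e (BEx i j \<phi>) \<longleftrightarrow> (\<exists>a\<in>elts (e j). true (e(i := a)) \<phi>)"
  by (simp add: BEx_def)

text \<open>A bounded quantifier at an element of a transitive class ranges over members that are
  already in the class. Hence \<open>true\<close> can stand for satisfaction in all the structures
  to be compared.\<close>

lemma Delta0_absolute:
  assumes "\<phi> \<in> Delta0" "trans_class M" "range e \<subseteq> M"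
  shows "sat M X Y e \<phi> \<longleftrightarrow> true e \<phi>"
  using assms
proof (induction \<phi> arbitrary: e rule: Delta0.induct)
  case (5 \<phi> i j)
  have "sat M X Y (e(i := a)) \<phi> \<longleftrightarrow> true (e(i := a)) \<phi>" if "a \<in> M" for a
    by (rule "5.IH") (use "5.prems" that in auto)
  moreover have "a \<in> M" if "a \<in> elts (e j)" for a
    using trans_classD[OF "5.prems"(1) _ that] "5.prems"(2) by auto
  ultimately show ?case using \<open>i \<noteq> j\<close> by auto
qed auto

text \<open>A block of like quantifiers becomes one quantifier over assignments \<open>g\<close>. As
  \<open>S\<close> is a set, the order and repetition of variables in the block disappear.\<close>

definition upd :: "nat set \<Rightarrow> 'v set \<Rightarrow> (nat \<Rightarrow> 'v) \<Rightarrow> (nat \<Rightarrow> 'v) \<Rightarrow> bool" where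
  "upd S M e g \<longleftrightarrow> (\<forall>i\<in>S. g i \<in> M) \<and> (\<forall>i. i \<notin> S \<longrightarrow> g i = e i)"

lemma upd_insert: "upd (insert i S) M e g \<longleftrightarrow> (\<exists>a\<in>M. upd S M (e(i := a)) g)"
proof
  assume "upd (insert i S) M e g"
  then show "\<exists>a\<in>M. upd S M (e(i := a)) g"
    by (intro bexI[of _ "g i"]) (auto simp: upd_def)
qed (auto simp: upd_def split: if_splits)

lemma sat_foldr_Forall:
  "sat M X Y e (foldr Forall vs \<phi>) \<longleftrightarrow> (\<forall>g. upd (set vs) M e g \<longrightarrow> sat M X Y g \<phi>)"
proof (induction vs arbitrary: e)
  case Nil
  have "upd {} M e g \<longleftrightarrow> g = e" for g by (auto simp: upd_def)
  then show ?case by simp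
next
  case (Cons v vs)
  then show ?case by (simp add: upd_insert del: fun_upd_apply) blast
qed

lemma sat_foldr_Exists:
  "sat M X Y e (foldr Exists vs \<phi>) \<longleftrightarrow> (\<exists>g. upd (set vs) M e g \<and> sat M X Y g \<phi>)"
proof (induction vs arbitrary: e)
  case Nil
  have "upd {} M e g \<longleftrightarrow> g = e" for g by (auto simp: upd_def)
  then show ?case by simp
next
  case (Cons v vs)
  then show ?case by (simp add: upd_insert del: fun_upd_apply) blast
qed

lemma upd_range: "upd S M e g \<Longrightarrow> range e \<subseteq> M \<Longrightarrow> range g \<subseteq> M"
  unfolding upd_def by (metis image_subset_iff range_subsetD)

lemma Sigma_elementary_2:
  assumes "trans_class M" "trans_class N" "M \<subseteq> N"
  shows "Sigma_elementary 2 M N \<longleftrightarrow>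
    (\<forall>us vs \<delta> e. \<delta> \<in> Delta0 \<longrightarrow> range e \<subseteq> M \<longrightarrow>
      (\<exists>f. upd (set us) M e f \<and> (\<forall>g. upd (set vs) M f g \<longrightarrow> true g \<delta>)) \<longleftrightarrow>
      (\<exists>f. upd (set us) N e f \<and> (\<forall>g. upd (set vs) N f g \<longrightarrow> true g \<delta>)))"
proof -
  have eq: "sat P {} {} e (foldr Exists us (foldr Forall vs \<delta>)) \<longleftrightarrow>
      (\<exists>f. upd (set us) P e f \<and> (\<forall>g. upd (set vs) P f g \<longrightarrow> true g \<delta>))"
    if "\<delta> \<in> Delta0" "trans_class P" "range e \<subseteq> P" for P e us vs \<delta>
  proof -
    have "sat P {} {} g \<delta> \<longleftrightarrow> true g \<delta>"
      if "upd (set us) P e f" "upd (set vs) P f g" for f g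
      by (rule Delta0_absolute[OF \<open>\<delta> \<in> Delta0\<close> \<open>trans_class P\<close>])
        (use that upd_range \<open>range e \<subseteq> P\<close> in metis)
    then show ?thesis
      unfolding sat_foldr_Exists sat_foldr_Forall by (simp cong: conj_cong imp_cong)
  qed
  have sig: "\<phi> \<in> Sigma_fm 2 \<longleftrightarrow> (\<exists>us vs \<delta>. \<delta> \<in> Delta0 \<and> \<phi> = foldr Exists us (foldr Forall vs \<delta>))" for \<phi>
    by (simp add: numeral_2_eq_2) blast
  have "Sigma_elementary 2 M N \<longleftrightarrow> (\<forall>us vs \<delta> e. \<delta> \<in> Delta0 \<longrightarrow> range e \<subseteq> M \<longrightarrow>
      sat M {} {} e (foldr Exists us (foldr Forall vs \<delta>)) = sat N {} {} e (foldr Exists us (foldr Forall vs \<delta>)))"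
    unfolding Sigma_elementary_def Ball_def sig by blast
  moreover have "range e \<subseteq> N" if "range e \<subseteq> M" for e :: "nat \<Rightarrow> 'v"
    using that assms(3) by (rule subset_trans)
  ultimately show ?thesis
    by (simp add: eq assms(1,2) cong: imp_cong)
qed

section \<open>Skolem hulls for bounded quantifiers and the Loewenheim-Skolem theorem\<close>

definition Skolem_closed :: "'v set \<Rightarrow> bool" where
  "Skolem_closed N \<longleftrightarrow> (\<forall>e i j \<phi> a. range e \<subseteq> N \<and> a \<in> elts (e j) \<and> \<not> true (e(i := a)) \<phi> \<and> i \<noteq> j \<longrightarrow>
    (\<exists>b\<in>N. b \<in> elts (e j) \<and> \<not> true (e(i := b)) \<phi>))"

lemma Skolem_closedD:
  "Skolem_closed N \<Longrightarrow> range e \<subseteq> N \<Longrightarrow> a \<in> elts (e j) \<Longrightarrow> \<not> true (e(i := a)) \<phi> \<Longrightarrow> i \<noteq> j \<Longrightarrow>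
    \<exists>b\<in>N. b \<in> elts (e j) \<and> \<not> true (e(i := b)) \<phi>"
  unfolding Skolem_closed_def by blast

text \<open>\<open>Skolem_closed\<close> is the Tarski-Vaught criterion for bounded quantifiers. The
  Skolem functions are indexed by two variables and a formula, hence by a countable type, so the
  general closure lemma applies.\<close>

lemma Delta0_Skolem_hull:
  fixes K :: "'k set"
  assumes "infinite K" "A \<lesssim> K"
  obtains N where "A \<subseteq> N" "N \<lesssim> K" "Skolem_closed N"
proof -
  \<comment> \<open>A list represents an assignment, with the empty set as default beyond its end.
    Finite lists suffice because a formula sees only finitely many variables.\<close>
  define asg where "asg xs n = (if n < length xs then xs ! n else mk {})" for xs :: "'v list" and n
  define F where "F = (\<lambda>(i, j, \<phi>) xs. SOME a. a \<in> elts (asg xs j) \<and> \<not> true ((asg xs)(i := a)) \<phi>)"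
  obtain N where N: "A \<subseteq> N" "N \<lesssim> K" "\<And>k xs. xs \<in> lists N \<Longrightarrow> F k xs \<in> N"
    using exists_closure_lepoll[OF assms, of F] by metis
  have "\<exists>a\<in>N. a \<in> elts (e j) \<and> \<not> true (e(i := a)) \<phi>"
    if e: "range e \<subseteq> N" and a: "a \<in> elts (e j)" "\<not> true (e(i := a)) \<phi>" and "i \<noteq> j" for e i j \<phi> a
  proof -
    obtain n where n: "n \<ge> Suc j" "vars_below n \<phi>" using exists_vars_below by blast
    define xs where "xs = map e [0..<n]"
    have xs: "asg xs k = e k" if "k < n" for k
      using that by (simp add: asg_def xs_def)
    have eq: "true ((asg xs)(i := b)) \<phi> \<longleftrightarrow> true (e(i := b)) \<phi>" for b
      by (rule sat_cong[OF n(2)]) (simp add: xs)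
    have j: "asg xs j = e j" using n(1) xs by simp
    have "F (i, j, \<phi>) xs \<in> elts (e j) \<and> \<not> true (e(i := F (i, j, \<phi>) xs)) \<phi>"
      unfolding F_def prod.case j eq by (rule someI[of _ a]) (use a in simp)
    moreover have "F (i, j, \<phi>) xs \<in> N" using e by (intro N(3)) (auto simp: xs_def subset_iff)
    ultimately show ?thesis by blast
  qed
  then have "Skolem_closed N" unfolding Skolem_closed_def by blast
  with N(1,2) show ?thesis by (rule that)
qed

text \<open>Take a Skolem hull \<open>N\<close> of \<open>A\<close> and the values of
  \<open>f\<close>, and collapse it. Skolem closure makes membership on \<open>N\<close> extensional
  and the collapse \<pi> truth-preserving for bounded formulas; \<pi> fixes \<open>A\<close>
  pointwise because \<open>A\<close> is transitive and included in \<open>N\<close>.\<close>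

lemma Delta0_Loewenheim_Skolem:
  fixes K A :: "'v set"
  assumes \<delta>: "\<delta> \<in> Delta0" and K: "infinite K" "small K" and A: "trans_class A" "A \<lesssim> K"
  obtains g T where "trans_class T" "A \<subseteq> T" "T \<lesssim> K" "range g \<subseteq> T"
    "\<And>i. f i \<in> A \<Longrightarrow> g i = f i" "true g \<delta> \<longleftrightarrow> true f \<delta>"
proof -
  have "A \<union> range f \<lesssim> K"
    using K A(2) countable_lepoll_infinite[of "range f" K] by (intro lepoll_Un_infinite) auto
  then obtain N where N: "A \<union> range f \<subseteq> N" "N \<lesssim> K" and closed: "Skolem_closed N"
    by (rule Delta0_Skolem_hull[OF K(1)])
  note wit = Skolem_closedD[OF closed]
  have sN: "small N" using K(2) N(2) by (rule small_lepoll)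
  define E where "E = {(a, b). a \<in> elts b \<and> a \<in> N \<and> b \<in> N}"
  have "wf E" by (rule wf_subset[OF foundation]) (auto simp: E_def)
  moreover have "E \<subseteq> N \<times> N" by (auto simp: E_def)
  ultimately obtain \<pi> where "\<And>b. elts (\<pi> b) = \<pi> ` {a. (a, b) \<in> E}"
    using collapse_exists[OF _ _ sN] by metis
  then have \<pi>: "elts (\<pi> b) = \<pi> ` (elts b \<inter> N)" if "b \<in> N" for b
    using that by (auto simp: E_def)
  \<comment> \<open>Skolem closure for the formula \<open>Mem 0 2\<close>: variable 0 is bounded by
    variable 1, which is \<open>x\<close>, and variable 2 is \<open>y\<close>.\<close>
  have ext: "\<exists>a\<in>N. a \<in> elts x \<and> a \<notin> elts y" if "x \<in> N" "y \<in> N" "a \<in> elts x" "a \<notin> elts y" for x y a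
    using wit[of "\<lambda>i. if i = 1 then x else y" a 1 0 "Mem 0 2"] that by auto
  have inj: "x = y" if "x \<in> N" "y \<in> N" "\<pi> x = \<pi> y" for x y
    using that
  proof (induction x arbitrary: y rule: mem_induct)
    case (step x)
    have "elts x = elts y"
    proof (rule ccontr)
      assume "elts x \<noteq> elts y"
      then consider a where "a \<in> elts x" "a \<notin> elts y" | a where "a \<in> elts y" "a \<notin> elts x" by blast
      then show False
      proof cases
        case 1
        then obtain a where a: "a \<in> N" "a \<in> elts x" "a \<notin> elts y" using ext step by blast
        then have "\<pi> a \<in> elts (\<pi> y)" using \<pi>[of x] step by auto
        then obtain b where "b \<in> N" "b \<in> elts y" "\<pi> a = \<pi> b" using \<pi>[of y] step by auto
        then show False using a step(1)[of a b] by auto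
      next
        case 2
        then obtain a where a: "a \<in> N" "a \<in> elts y" "a \<notin> elts x" using ext step by blast
        then have "\<pi> a \<in> elts (\<pi> x)" using \<pi>[of y] step by auto
        then obtain b where "b \<in> N" "b \<in> elts x" "\<pi> b = \<pi> a" using \<pi>[of x] step by auto
        then show False using a step(1)[of b a] by auto
      qed
    qed
    then show ?case by (rule extensionality)
  qed
  have fix_A: "x \<in> A \<Longrightarrow> \<pi> x = x" for x
  proof (induction x rule: mem_induct)
    case (step x)
    have "elts x \<subseteq> A" using A(1) step(2) by (auto simp: trans_class_def)
    then have "elts x \<inter> N = elts x" using N(1) by auto
    then have "elts (\<pi> x) = \<pi> ` elts x" using \<pi>[of x] step N(1) by auto
    also have "\<dots> = elts x" using step \<open>elts x \<subseteq> A\<close> by force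
    finally show ?case by (rule extensionality)
  qed
  have truth: "true (\<pi> \<circ> e) \<phi> \<longleftrightarrow> true e \<phi>" if "\<phi> \<in> Delta0" "range e \<subseteq> N" for e \<phi>
    using that
  proof (induction \<phi> arbitrary: e rule: Delta0.induct)
    case (1 i j)
    have "e i \<in> N" "e j \<in> N" using 1 by auto
    then have "\<pi> (e i) \<in> \<pi> ` (elts (e j) \<inter> N) \<longleftrightarrow> e i \<in> elts (e j)" using inj by blast
    then show ?case using \<pi>[OF \<open>e j \<in> N\<close>] by simp
  next
    case (2 i j)
    then show ?case using inj[of "e i" "e j"] by auto
  next
    case (5 \<phi> i j)
    have upd: "true ((\<pi> \<circ> e)(i := \<pi> a)) \<phi> \<longleftrightarrow> true (e(i := a)) \<phi>" if "a \<in> N" for a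
    proof -
      have "range (e(i := a)) \<subseteq> N" using "5.prems" that by auto
      moreover have "(\<pi> \<circ> e)(i := \<pi> a) = \<pi> \<circ> e(i := a)" by auto
      ultimately show ?thesis using "5.IH" by (simp only:)
    qed
    have "(\<forall>a\<in>elts ((\<pi> \<circ> e) j). true ((\<pi> \<circ> e)(i := a)) \<phi>) \<longleftrightarrow> (\<forall>a\<in>elts (e j) \<inter> N. true (e(i := a)) \<phi>)"
    proof -
      have "e j \<in> N" using "5.prems" by auto
      then have "elts ((\<pi> \<circ> e) j) = \<pi> ` (elts (e j) \<inter> N)" by (simp add: \<pi>)
      then show ?thesis using upd by (simp del: fun_upd_apply o_apply)
    qed
    \<comment> \<open>If there is a counterexample at all, Skolem closure provides one inside
      \<open>N\<close>.\<close>
    also have "\<dots> \<longleftrightarrow> (\<forall>a\<in>elts (e j). true (e(i := a)) \<phi>)"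
      using wit[OF "5.prems" _ _ "5.hyps"(2)] by blast
    finally show ?case unfolding BAll_def[symmetric] true_BAll[OF "5.hyps"(2)] .
  qed auto
  show ?thesis
  proof
    show "trans_class (\<pi> ` N)" using \<pi> by (auto simp: trans_class_def)
    show "A \<subseteq> \<pi> ` N" using fix_A N(1) by force
    show "\<pi> ` N \<lesssim> K" using image_lepoll N(2) by (rule lepoll_trans)
    show "range (\<pi> \<circ> f) \<subseteq> \<pi> ` N" using N(1) by auto
    show "(\<pi> \<circ> f) i = f i" if "f i \<in> A" for i using fix_A that by simp
    show "true (\<pi> \<circ> f) \<delta> \<longleftrightarrow> true f \<delta>" using N(1) by (intro truth \<delta>) auto
  qed
qed

end

subsection \<open>Reflection from elementarity\<close>

text \<open>Satisfaction in the structure with universe \<open>m\<close> becomes a bounded formula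
  about \<open>m\<close>: quantifiers are bounded by \<open>m\<close>, and the two predicates become
  the set variables \<open>x\<close> and \<open>y\<close>.\<close>

primrec relativize :: "nat \<Rightarrow> nat \<Rightarrow> nat \<Rightarrow> fm \<Rightarrow> fm" where
  "relativize m x y (Mem i j) = Mem i j"
| "relativize m x y (Eq i j) = Eq i j"
| "relativize m x y (InX i) = Mem i x"
| "relativize m x y (InY i) = Mem i y"
| "relativize m x y (Neg \<phi>) = Neg (relativize m x y \<phi>)"
| "relativize m x y (And \<phi> \<psi>) = And (relativize m x y \<phi>) (relativize m x y \<psi>)"
| "relativize m x y (Forall i \<phi>) = BAll i m (relativize m x y \<phi>)"

lemma relativize_Delta0:
  "vars_below n \<phi> \<Longrightarrow> n \<le> m \<Longrightarrow> relativize m x y \<phi> \<in> Delta0"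
  by (induction \<phi>) (auto intro!: Delta0_intros)

context zfc_universe
begin

lemma true_relativize:
  assumes "vars_below n \<phi>" "n \<le> m" "n \<le> x" "n \<le> y"
  shows "true e (relativize m x y \<phi>) \<longleftrightarrow> sat (elts (e m)) (elts (e x)) (elts (e y)) e \<phi>"
  using assms by (induction \<phi> arbitrary: e) auto

lemma mem_H_card_succI:
  assumes "cardinal \<kappa>" "trans_class M" "M \<lesssim> elts \<kappa>" "elts x \<subseteq> M"
  shows "x \<in> H (card_succ \<kappa>)"
  using tc_least[OF assms(2,4)] assms(3)
  unfolding H_card_succ[OF assms(1)] by (auto intro: lepoll_trans[OF subset_imp_lepoll])

lemma trans_class_H_card_succ:
  assumes "cardinal \<kappa>"
  shows "trans_class (H (card_succ \<kappa>))"
  unfolding trans_class_def H_card_succ[OF assms]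
proof (intro ballI subsetI)
  fix x y assume "x \<in> {x. tc x \<lesssim> elts \<kappa>}" "y \<in> elts x"
  then have "tc x \<lesssim> elts \<kappa>" "tc y \<subseteq> tc x" using elts_subset_tc[of x] tc_mono[of y x] by auto
  then show "y \<in> {x. tc x \<lesssim> elts \<kappa>}" using lepoll_trans[OF subset_imp_lepoll] by auto
qed

text \<open>
  The set \<open>h\<close> is to be \<open>{V \<beta> | \<beta> < \<xi>}\<close> and \<open>m\<close> is to be
  \<open>V \<xi>\<close>. Being of this form is expressed with one unbounded universal quantifier,
  over \<open>y\<close>, which is shared with the second-order quantifier over subsets of \<open>m\<close>.
\<close>

definition V_history :: "'v set \<Rightarrow> 'v \<Rightarrow> 'v \<Rightarrow> bool" where
  "V_history N h m \<longleftrightarrow> (\<forall>y\<in>N. (y \<in> elts m \<longleftrightarrow> (\<exists>w\<in>elts h. elts y \<subseteq> elts w)) \<and>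
     (\<forall>v\<in>elts h. y \<in> elts v \<longleftrightarrow> (\<exists>w\<in>elts h. w \<in> elts v \<and> elts y \<subseteq> elts w)))"

text \<open>The main point is \<open>V_mem\<close>: among the levels, membership between
  \<open>V \<gamma>\<close> and \<open>V \<beta>\<close> reflects the order of the indices.\<close>

lemma V_history_V:
  assumes "ordinal \<alpha>"
  defines "h \<equiv> mk ((\<lambda>\<beta>. mk (V \<beta>)) ` elts \<alpha>)"
  shows "V_history N h (mk (V \<alpha>))"
  unfolding V_history_def
proof (intro ballI conjI)
  have h: "elts h = (\<lambda>\<beta>. mk (V \<beta>)) ` elts \<alpha>" unfolding h_def by simp
  fix y
  show "y \<in> elts (mk (V \<alpha>)) \<longleftrightarrow> (\<exists>w\<in>elts h. elts y \<subseteq> elts w)"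
    by (simp add: h V_iff[of y \<alpha>])
  fix v assume "v \<in> elts h"
  then obtain \<beta> where \<beta>: "\<beta> \<in> elts \<alpha>" "elts v = V \<beta>" by (auto simp: h)
  have V_mem: "mk (V \<gamma>) \<in> V \<beta> \<longleftrightarrow> \<gamma> \<in> elts \<beta>" if \<gamma>: "\<gamma> \<in> elts \<alpha>" for \<gamma>
  proof
    assume "mk (V \<gamma>) \<in> V \<beta>"
    then obtain \<delta> where \<delta>: "\<delta> \<in> elts \<beta>" "V \<gamma> \<subseteq> V \<delta>" by (auto simp: V_iff[of _ \<beta>])
    \<comment> \<open>From \<open>V \<gamma> \<subseteq> V \<delta>\<close> this excludes \<delta>
      below \<gamma>, since \<delta> would then belong to \<open>V \<delta>\<close>. Linearity
      leaves \<gamma> equal to or below \<delta>, hence below \<beta>.\<close>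
    have "\<delta> \<notin> elts \<gamma>"
    proof
      assume "\<delta> \<in> elts \<gamma>"
      then have "\<delta> \<in> V \<gamma>" using ordinal_subset_V[OF ordinal_mem[OF assms(1) \<gamma>]] by auto
      then show False using \<delta>(2) not_mem_V_self by blast
    qed
    moreover have "ordinal \<beta>" using ordinal_mem[OF assms(1) \<beta>(1)] .
    ultimately show "\<gamma> \<in> elts \<beta>"
      using ordinal_linear[of \<gamma> \<delta>] ordinal_mem[OF assms(1) \<gamma>] ordinal_mem[of \<beta> \<delta>]
        ordinal_mem_trans[of \<beta> \<delta> \<gamma>] \<delta>(1) by auto
  next
    assume "\<gamma> \<in> elts \<beta>"
    then show "mk (V \<gamma>) \<in> V \<beta>" by (auto simp: V_iff[of _ \<beta>])
  qed
  have "y \<in> V \<beta> \<longleftrightarrow> (\<exists>\<gamma>\<in>elts \<alpha>. \<gamma> \<in> elts \<beta> \<and> elts y \<subseteq> V \<gamma>)"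
    using ordinal_mem_trans[OF assms(1) \<beta>(1)] by (auto simp: V_iff[of y \<beta>])
  then show "y \<in> elts v \<longleftrightarrow> (\<exists>w\<in>elts h. w \<in> elts v \<and> elts y \<subseteq> elts w)"
    by (auto simp: h \<beta>(2) V_mem)
qed

text \<open>Closure of \<open>N\<close> under subsets of its elements and under members makes both
  sides of each equivalence false for \<open>y\<close> outside \<open>N\<close>, so the equivalences
  hold for all \<open>y\<close>. Induction on membership then shows every element of
  \<open>h\<close> to be a level of the hierarchy, and finally \<open>m\<close>.\<close>

lemma V_historyD:
  assumes hist: "V_history N h m" and N: "m \<in> N" "h \<in> N" "trans_class N"
    and sub: "\<And>x y. x \<in> N \<Longrightarrow> elts y \<subseteq> elts x \<Longrightarrow> y \<in> N"
  obtains \<alpha> where "ordinal \<alpha>" "elts m = V \<alpha>"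
proof -
  have hN: "w \<in> N" if "w \<in> elts h" for w using trans_classD[OF N(3,2) that] .
  have "\<exists>\<alpha>. V \<alpha> = elts v" if "v \<in> elts h" for v
    using that
  proof (induction v rule: mem_induct)
    case (step v)
    then obtain r where r: "\<And>w. w \<in> elts v \<Longrightarrow> w \<in> elts h \<Longrightarrow> V (r w) = elts w" by metis
    have iff: "y \<in> elts v \<longleftrightarrow> (\<exists>w\<in>elts h. w \<in> elts v \<and> elts y \<subseteq> elts w)" for y
    proof (cases "y \<in> N")
      case True
      then show ?thesis using hist step(2) by (auto simp: V_history_def)
    next
      case False
      then show ?thesis using sub hN trans_classD[OF N(3) hN[OF step(2)]] by metis
    qed
    \<comment> \<open>The set of indices chosen for the earlier levels serves as index for
      \<open>v\<close>. It need not be an ordinal; \<open>exists_rank\<close> repairs this at the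
      end.\<close>
    define B where "B = r ` (elts h \<inter> elts v)"
    have sB: "small B" unfolding B_def by (intro small_image small_subset[OF small_elts]) auto
    have "y \<in> V (mk B) \<longleftrightarrow> y \<in> elts v" for y
      unfolding V_iff[of y "mk B"] elts_mk[OF sB] iff[of y] using r by (auto simp: B_def)
    then show ?case by blast
  qed
  then obtain r where r: "\<And>w. w \<in> elts h \<Longrightarrow> V (r w) = elts w" by metis
  have iff: "y \<in> elts m \<longleftrightarrow> (\<exists>w\<in>elts h. elts y \<subseteq> elts w)" for y
  proof (cases "y \<in> N")
    case True
    then show ?thesis using hist by (auto simp: V_history_def)
  next
    case False
    then show ?thesis using sub hN trans_classD[OF N(3) N(1)] by metis
  qed
  have "y \<in> V (mk (r ` elts h)) \<longleftrightarrow> y \<in> elts m" for y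
    unfolding V_iff[of y "mk (r ` elts h)"] iff[of y] using r by auto
  then have "V (mk (r ` elts h)) = elts m" by blast
  then show ?thesis using exists_rank that by metis
qed

text \<open>All auxiliary variables are at least \<open>n\<close>, hence fresh for \<Phi>. Variable
  \<open>n + 6\<close> is never quantified and keeps the value of the constant assignment, so it
  names the parameter. One \<open>y\<close> serves both the description of the hierarchy and the
  second-order variable.\<close>

definition reflection_matrix :: "nat \<Rightarrow> fm \<Rightarrow> fm" where
  "reflection_matrix n \<Phi> =
    (let y = n; x = Suc n; m = n + 2; h = n + 3; w = n + 4; v = n + 5; p = n + 6; z = n + 7;
         sub = (\<lambda>i j. BAll z i (Mem z j))
     in And (And (Mem p m) (sub x m))
       (And (And (Iff (Mem y m) (BEx w h (sub y w)))
          (BAll v h (Iff (Mem y v) (BEx w h (And (Mem w v) (sub y w))))))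
        (Imp (sub y m) (relativize m x y \<Phi>))))"

lemma reflection_matrix_Delta0:
  "vars_below n \<Phi> \<Longrightarrow> reflection_matrix n \<Phi> \<in> Delta0"
  unfolding reflection_matrix_def Let_def
  by (intro Delta0_intros relativize_Delta0[of n]) auto

lemma true_reflection_matrix:
  assumes "vars_below n \<Phi>"
  shows "true ((\<lambda>_. p)(n + 3 := h, n + 2 := m, Suc n := x, n := y)) (reflection_matrix n \<Phi>) \<longleftrightarrow>
    (p \<in> elts m \<and> elts x \<subseteq> elts m) \<and>
    ((y \<in> elts m \<longleftrightarrow> (\<exists>w\<in>elts h. elts y \<subseteq> elts w)) \<and>
     (\<forall>v\<in>elts h. y \<in> elts v \<longleftrightarrow> (\<exists>w\<in>elts h. w \<in> elts v \<and> elts y \<subseteq> elts w))) \<and>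
    (elts y \<subseteq> elts m \<longrightarrow> sat (elts m) (elts x) (elts y) (\<lambda>_. p) \<Phi>)"
proof -
  let ?e = "(\<lambda>_. p)(n + 3 := h, n + 2 := m, Suc n := x, n := y)"
  have "true ?e (relativize (n + 2) (Suc n) n \<Phi>) \<longleftrightarrow> sat (elts m) (elts x) (elts y) ?e \<Phi>"
    using true_relativize[OF assms, of "n + 2" "Suc n" n ?e] by simp
  also have "\<dots> \<longleftrightarrow> sat (elts m) (elts x) (elts y) (\<lambda>_. p) \<Phi>"
    by (rule sat_cong[OF assms]) simp
  finally have rel: "true ?e (relativize (n + 2) (Suc n) n \<Phi>) \<longleftrightarrow>
    sat (elts m) (elts x) (elts y) (\<lambda>_. p) \<Phi>" .
  show ?thesis
    unfolding reflection_matrix_def Let_def sat.simps(5,6) sat_Imp rel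
    by (simp add: subset_eq)
qed

end

context inaccessible_cardinal
begin

lemma subset_mem_V_\<kappa>: "x \<in> V \<kappa> \<Longrightarrow> elts y \<subseteq> elts x \<Longrightarrow> y \<in> V \<kappa>"
  unfolding V_\<kappa>_iff[of x] V_\<kappa>_iff[of y] by (meson lesspoll_trans1 subset_imp_lepoll subset_trans)

lemma V_\<kappa>_subset_H_card_succ: "V \<kappa> \<subseteq> H (card_succ \<kappa>)"
  using trans_class_V[of \<kappa>] mem_H_card_succI[OF card_\<kappa> trans_class_V V_\<kappa>_lepoll]
  by (auto simp: trans_class_def)

lemma Sigma_elementary_iff:
  "Sigma_elementary 2 (H \<kappa>) (H (card_succ \<kappa>)) \<longleftrightarrow>
    (\<forall>us vs \<delta> e. \<delta> \<in> Delta0 \<longrightarrow> range e \<subseteq> V \<kappa> \<longrightarrow>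
      (\<exists>f. upd (set us) (V \<kappa>) e f \<and> (\<forall>g. upd (set vs) (V \<kappa>) f g \<longrightarrow> true g \<delta>)) \<longleftrightarrow>
      (\<exists>f. upd (set us) (H (card_succ \<kappa>)) e f \<and> (\<forall>g. upd (set vs) (H (card_succ \<kappa>)) f g \<longrightarrow> true g \<delta>)))"
  unfolding H_\<kappa>_eq_V
  by (intro Sigma_elementary_2 trans_class_V trans_class_H_card_succ card_\<kappa> V_\<kappa>_subset_H_card_succ)

text \<open>The sentence \<psi> says that some level \<open>m\<close> of the hierarchy, with history
  \<open>h\<close>, contains the parameter and has a subset \<open>x\<close> witnessing the
  second-order statement. In the larger structure \<open>V \<kappa>\<close> is such a level;
  elementarity yields one inside \<open>V \<kappa>\<close>.\<close>

lemma Sigma_elementary_imp_reflection: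
  assumes elem: "Sigma_elementary 2 (H \<kappa>) (H (card_succ \<kappa>))"
  shows "Sigma12_reflection \<kappa>"
  unfolding Sigma12_reflection_def
proof (intro allI ballI impI)
  fix \<Phi> p
  assume p: "p \<in> V \<kappa>" and "sat_Sigma12 (V \<kappa>) \<Phi> p"
  then obtain X where X: "X \<subseteq> V \<kappa>" "\<And>Y. Y \<subseteq> V \<kappa> \<Longrightarrow> sat (V \<kappa>) X Y (\<lambda>_. p) \<Phi>"
    unfolding sat_Sigma12_def by blast
  obtain n where n: "vars_below n \<Phi>" using exists_vars_below by blast
  define \<psi> where "\<psi> = foldr Exists [n + 3, n + 2, Suc n] (foldr Forall [n] (reflection_matrix n \<Phi>))"
  have "\<psi> \<in> Sigma_fm 2"
    using reflection_matrix_Delta0[OF n] unfolding \<psi>_def numeral_2_eq_2 Sigma_fm.simps Pi_fm.simps by blast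
  moreover have "range (\<lambda>_::nat. p) \<subseteq> V \<kappa>" using p by auto
  ultimately have transfer: "sat (V \<kappa>) {} {} (\<lambda>_. p) \<psi> \<longleftrightarrow> sat (H (card_succ \<kappa>)) {} {} (\<lambda>_. p) \<psi>"
    using elem unfolding Sigma_elementary_def H_\<kappa>_eq_V by blast
  have sat_\<psi>: "sat N {} {} (\<lambda>_. p) \<psi> \<longleftrightarrow> (\<exists>h\<in>N. \<exists>m\<in>N. \<exists>x\<in>N. \<forall>y\<in>N.
      true ((\<lambda>_. p)(n + 3 := h, n + 2 := m, Suc n := x, n := y)) (reflection_matrix n \<Phi>))"
    if "trans_class N" "p \<in> N" for N
  proof -
    have "sat N {} {} ((\<lambda>_. p)(n + 3 := h, n + 2 := m, Suc n := x, n := y)) (reflection_matrix n \<Phi>) \<longleftrightarrow>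
      true ((\<lambda>_. p)(n + 3 := h, n + 2 := m, Suc n := x, n := y)) (reflection_matrix n \<Phi>)"
      if "h \<in> N" "m \<in> N" "x \<in> N" "y \<in> N" for h m x y
      using that \<open>p \<in> N\<close>
      by (intro Delta0_absolute reflection_matrix_Delta0[OF n] \<open>trans_class N\<close>) auto
    then show ?thesis by (simp add: \<psi>_def del: fun_upd_apply)
  qed
  define h where "h = mk ((\<lambda>\<beta>. mk (V \<beta>)) ` elts \<kappa>)"
  have mkV: "mk (V \<beta>) \<in> V \<kappa>" if "\<beta> \<in> elts \<kappa>" for \<beta>
    using that by (auto simp: V_iff[of _ \<kappa>])
  have sX: "small X" using X(1) by (rule small_subset[OF small_V])
  have mems: "h \<in> H (card_succ \<kappa>)" "mk (V \<kappa>) \<in> H (card_succ \<kappa>)" "mk X \<in> H (card_succ \<kappa>)"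
    using mkV X(1) sX
    by (auto intro!: mem_H_card_succI[OF card_\<kappa> trans_class_V V_\<kappa>_lepoll] simp: h_def)
  have hist: "V_history (H (card_succ \<kappa>)) h (mk (V \<kappa>))"
    unfolding h_def by (rule V_history_V[OF ord_\<kappa>])
  have "sat (H (card_succ \<kappa>)) {} {} (\<lambda>_. p) \<psi>"
    unfolding sat_\<psi>[OF trans_class_H_card_succ[OF card_\<kappa>] subsetD[OF V_\<kappa>_subset_H_card_succ p]] true_reflection_matrix[OF n]
    using hist[unfolded V_history_def] X sX p
    by (intro bexI[OF _ mems(1)] bexI[OF _ mems(2)] bexI[OF _ mems(3)] ballI) simp
  then have "sat (V \<kappa>) {} {} (\<lambda>_. p) \<psi>" using transfer by simp
  then obtain h m x where hmx: "h \<in> V \<kappa>" "m \<in> V \<kappa>" "x \<in> V \<kappa>"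
    and "\<forall>y\<in>V \<kappa>. true ((\<lambda>_. p)(n + 3 := h, n + 2 := m, Suc n := x, n := y)) (reflection_matrix n \<Phi>)"
    unfolding sat_\<psi>[OF trans_class_V p] by (elim bexE)
  note * = bspec[OF this(4)[unfolded true_reflection_matrix[OF n]]]
  have "V_history (V \<kappa>) h m" unfolding V_history_def by (intro ballI) (use * in blast)
  then obtain \<xi> where \<xi>: "ordinal \<xi>" "elts m = V \<xi>"
    by (rule V_historyD[OF _ hmx(2,1) trans_class_V subset_mem_V_\<kappa>])
  \<comment> \<open>The members of \<xi> lie in \<open>V \<xi>\<close>, which is
    \<open>elts m\<close>, so \<xi> is a subset of an element of \<open>V \<kappa>\<close>. This
    forces \<xi> below \<kappa>.\<close>
  have "\<xi> \<in> V \<kappa>" using subset_mem_V_\<kappa>[OF hmx(2)] ordinal_subset_V[OF \<xi>(1)] \<xi>(2) by simp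
  then have "\<kappa> \<notin> elts \<xi>" "\<kappa> \<noteq> \<xi>"
    using trans_classD[OF trans_class_V] not_mem_V_self by blast+
  then have "\<xi> \<in> elts \<kappa>" using ordinal_linear[OF \<xi>(1) ord_\<kappa>] by auto
  moreover have "p \<in> V \<xi>" "elts x \<subseteq> V \<xi>" using *[OF p] \<xi>(2) by auto
  moreover have "sat (V \<xi>) (elts x) Y (\<lambda>_. p) \<Phi>" if "Y \<subseteq> V \<xi>" for Y
  proof -
    \<comment> \<open>Every subset of \<open>V \<xi>\<close> is a set in \<open>V \<kappa>\<close>,
      so the first-order variable \<open>y\<close> has run through all values of the second-order
      one.\<close>
    have "small Y" using that by (rule small_subset[OF small_V])
    then show ?thesis
      using *[of "mk Y"] subset_mem_V_\<kappa>[OF hmx(2), of "mk Y"] that \<xi>(2) by simp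
  qed
  ultimately show "\<exists>\<xi>\<in>elts \<kappa>. p \<in> V \<xi> \<and> sat_Sigma12 (V \<xi>) \<Phi> p"
    unfolding sat_Sigma12_def by blast
qed

text \<open>A counterexample anywhere in the universe can be shrunk by Loewenheim-Skolem to size
  less than \<kappa> while the parameters stay fixed, and then it lies in
  \<open>V \<kappa>\<close>.\<close>

lemma Pi1_upward:
  assumes \<delta>: "\<delta> \<in> Delta0" and f: "range f \<subseteq> V \<kappa>"
    and true: "\<And>g. upd S (V \<kappa>) f g \<Longrightarrow> true g \<delta>"
    and g: "\<And>i. i \<notin> S \<Longrightarrow> g i = f i"
  shows "true g \<delta>"
proof -
  \<comment> \<open>\<open>C\<close> ensures that the level \<open>V \<beta>\<close> containing the
    countably many parameters is infinite, as Loewenheim-Skolem demands.\<close>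
  obtain C where C: "C \<subseteq> V \<kappa>" "countable C" "infinite C"
    using infinite_countable_subset'[OF infinite_V_\<kappa>] by blast
  have "range f \<union> C \<subseteq> V \<kappa>" "range f \<union> C \<prec> elts \<kappa>"
    using f C by (auto intro!: countable_lesspoll_\<kappa>)
  then obtain \<beta> where \<beta>: "\<beta> \<in> elts \<kappa>" "range f \<union> C \<subseteq> V \<beta>"
    by (rule V_\<kappa>_bounded_subset)
  have "infinite (V \<beta>)" using C(3) \<beta>(2) by (meson finite_subset le_sup_iff)
  then obtain g' T where T: "trans_class T" "T \<lesssim> V \<beta>" "range g' \<subseteq> T"
    and g': "\<And>i. g i \<in> V \<beta> \<Longrightarrow> g' i = g i" "true g' \<delta> \<longleftrightarrow> true g \<delta>"
    using Delta0_Loewenheim_Skolem[OF \<delta> _ small_V trans_class_V lepoll_refl] by metis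
  have "T \<prec> elts \<kappa>" using T(2) V_lesspoll_\<kappa>[OF \<beta>(1)] by (rule lesspoll_trans1)
  moreover have "tc (g' i) \<subseteq> T" for i
    using T by (intro tc_least) (auto simp: trans_class_def)
  ultimately have "tc (g' i) \<prec> elts \<kappa>" for i
    using lesspoll_trans1[OF subset_imp_lepoll] by metis
  then have "g' i \<in> V \<kappa>" for i
    unfolding H_\<kappa>_eq_V[symmetric] H_def by simp
  moreover have "g' i = f i" if "i \<notin> S" for i
    using g'(1)[of i] g[OF that] \<beta>(2) by auto
  ultimately have "upd S (V \<kappa>) f g'" by (simp add: upd_def)
  then show ?thesis using true g'(2) by blast
qed

end

subsection \<open>Coding transitive sets by relations\<close>

context zfc_universe
begin

definition up :: "'v \<Rightarrow> 'v \<Rightarrow> 'v" where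
  "up a b = mk {a, b}"

abbreviation sing :: "'v \<Rightarrow> 'v" where
  "sing a \<equiv> up a a"

definition pair :: "'v \<Rightarrow> 'v \<Rightarrow> 'v" where
  "pair a b = up (sing a) (up a b)"

lemma elts_up [simp]: "elts (up a b) = {a, b}"
  by (simp add: up_def)

lemma eq_up_iff: "x = up a b \<longleftrightarrow> elts x = {a, b}"
  using extensionality[of x "up a b"] by auto

lemma sing_eq_iff [simp]: "sing a = sing b \<longleftrightarrow> a = b"
  by (metis elts_up insertI1 singletonD insert_absorb2)

lemma pair_eq_iff [simp]: "pair a b = pair c d \<longleftrightarrow> a = c \<and> b = d"
  unfolding pair_def eq_up_iff elts_up doubleton_eq_iff by (auto simp: eq_up_iff doubleton_eq_iff)

definition upclosed :: "'v set \<Rightarrow> bool" where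
  "upclosed M \<longleftrightarrow> (\<forall>a\<in>M. \<forall>b\<in>M. up a b \<in> M)"

lemma upclosed_pair: "upclosed M \<Longrightarrow> a \<in> M \<Longrightarrow> b \<in> M \<Longrightarrow> pair a b \<in> M"
  by (simp add: upclosed_def pair_def)

text \<open>On a finite \<open>M\<close> the injection \<open>sing\<close> would be onto, so a
  membership-minimal element of \<open>M\<close> would be the singleton of an element of
  \<open>M\<close>.\<close>

lemma upclosed_infinite:
  assumes "upclosed M" "M \<noteq> {}"
  shows "infinite M"
proof
  assume "finite M"
  obtain m where m: "m \<in> M" "\<And>y. y \<in> elts m \<Longrightarrow> y \<notin> M"
    using assms(2) mem_minimal by (metis all_not_in_conv)
  have "sing ` M \<subseteq> M" using assms(1) by (auto simp: upclosed_def)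
  moreover have "inj_on sing M" by (auto intro: inj_onI)
  ultimately have "sing ` M = M" using \<open>finite M\<close> by (simp add: endo_inj_surj)
  then obtain a where "a \<in> M" "m = sing a" using m(1) by auto
  then show False using m(2)[of a] by simp
qed

definition rel :: "'v set \<Rightarrow> ('v \<times> 'v) set" where
  "rel X = {(a, b). pair a b \<in> X}"

lemma rel_subset: "trans_class M \<Longrightarrow> X \<subseteq> M \<Longrightarrow> rel X \<subseteq> M \<times> M"
proof (clarify, goal_cases)
  case (1 a b)
  then have "pair a b \<in> M" by (auto simp: rel_def)
  moreover have "up a b \<in> elts (pair a b)" by (simp add: pair_def)
  ultimately have "up a b \<in> M" using 1(1) trans_classD by blast
  then show ?case using 1(1) trans_classD[of M "up a b"] by simp
qed

lemma exists_rel: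
  assumes "upclosed M" "F \<subseteq> M \<times> M"
  obtains X where "X \<subseteq> M" "rel X = F"
proof
  show "(\<lambda>(a, b). pair a b) ` F \<subseteq> M"
    using assms upclosed_pair by auto
  show "rel ((\<lambda>(a, b). pair a b) ` F) = F"
    by (auto simp: rel_def)
qed

text \<open>
  A relation \<open>E\<close> is used as a code for a transitive class: the elements of
  \<open>Domain E\<close> are the codes of its members. Every member has to belong to something
  coded by \<open>E\<close>, which is achieved by one additional top element outside the domain.
\<close>

definition extensional_rel :: "('v \<times> 'v) set \<Rightarrow> bool" where
  "extensional_rel E \<longleftrightarrow>
    (\<forall>a\<in>Domain E. \<forall>b\<in>Domain E. (\<forall>c. (c, a) \<in> E \<longleftrightarrow> (c, b) \<in> E) \<longrightarrow> a = b)"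

definition decodes :: "('v \<Rightarrow> 'v) \<Rightarrow> ('v \<times> 'v) set \<Rightarrow> bool" where
  "decodes \<pi> E \<longleftrightarrow> (\<forall>b\<in>Domain E. elts (\<pi> b) = \<pi> ` {a. (a, b) \<in> E})"

text \<open>
  The code \<open>b\<close> of \<open>E\<close> becomes \<open>{b}\<close> in \<open>F\<close>, so that the
  sets with two elements remain available as new codes.
\<close>

definition extends :: "('v \<times> 'v) set \<Rightarrow> ('v \<times> 'v) set \<Rightarrow> bool" where
  "extends E F \<longleftrightarrow> (\<forall>b\<in>Domain E. sing b \<in> Domain F \<and>
    (\<forall>a. (a, sing b) \<in> F \<longleftrightarrow> (\<exists>c. (c, b) \<in> E \<and> a = sing c)))"

definition mem_rel :: "'v set \<Rightarrow> ('v \<times> 'v) set" where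
  "mem_rel M = {(a, b). a \<in> M \<and> b \<in> M \<and> a \<in> elts b}"

text \<open>Each \<open>a\<close> in \<open>M\<close> is a member of \<open>sing a\<close>, which is
  in \<open>M\<close>; so the universe itself fits the convention that coded sets form the
  domain.\<close>

lemma Domain_mem_rel: "upclosed M \<Longrightarrow> Domain (mem_rel M) = M"
  by (force simp: mem_rel_def upclosed_def Domain_iff)

lemma decodes_mem_rel:
  assumes "trans_class M"
  shows "decodes id (mem_rel M)"
  using assms by (auto simp: decodes_def mem_rel_def dest: trans_classD)

lemma extensional_mem_rel:
  assumes "trans_class M"
  shows "extensional_rel (mem_rel M)"
  unfolding extensional_rel_def
proof (intro ballI impI)
  fix a b assume ab: "a \<in> Domain (mem_rel M)" "b \<in> Domain (mem_rel M)"
    and "\<forall>c. (c, a) \<in> mem_rel M \<longleftrightarrow> (c, b) \<in> mem_rel M"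
  moreover have "a \<in> M" "b \<in> M" using ab by (auto simp: mem_rel_def)
  ultimately have "elts a = elts b"
    using trans_classD[OF assms] by (auto simp: mem_rel_def)
  then show "a = b" by (rule extensionality)
qed

text \<open>Induction on the common value: equal values have equal members, whose codes agree by
  induction, so the two codes have the same predecessors.\<close>

lemma decodes_inj:
  assumes "decodes \<pi> E" "extensional_rel E"
  shows "inj_on \<pi> (Domain E)"
proof -
  have "\<forall>a\<in>Domain E. \<forall>b\<in>Domain E. \<pi> a = x \<longrightarrow> \<pi> b = x \<longrightarrow> a = b" for x
  proof (induction x rule: mem_induct)
    case (step x)
    have sub: "(c, b) \<in> E"
      if "a \<in> Domain E" "b \<in> Domain E" "\<pi> a = x" "\<pi> b = x" "(c, a) \<in> E" for a b c
    proof -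
      have x: "elts x = \<pi> ` {u. (u, a) \<in> E}" "elts x = \<pi> ` {u. (u, b) \<in> E}"
        using bspec[OF assms(1)[unfolded decodes_def] that(1)] bspec[OF assms(1)[unfolded decodes_def] that(2)]
        by (simp_all only: that(3,4))
      have "\<pi> c \<in> elts x" unfolding x(1) using that(5) by simp
      then obtain d where "(d, b) \<in> E" "\<pi> c = \<pi> d" unfolding x(2) by auto
      then show ?thesis
        using step[OF \<open>\<pi> c \<in> elts x\<close>] that(5) by (metis Domain.DomainI)
    qed
    show ?case
    proof (intro ballI impI)
      fix a b assume "a \<in> Domain E" "b \<in> Domain E" "\<pi> a = x" "\<pi> b = x"
      then show "a = b"
        using assms(2) sub[of a b] sub[of b a] unfolding extensional_rel_def by blast
    qed
  qed
  then show ?thesis unfolding inj_on_def by metis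
qed

lemma decodes_trans_class:
  assumes "decodes \<pi> E"
  shows "trans_class (\<pi> ` Domain E)"
  using assms by (auto simp: decodes_def trans_class_def)

text \<open>Passing to a larger code preserves what is decoded, up to replacing \<open>b\<close> by
  \<open>sing b\<close>. The induction is on the decoded set, which makes well-foundedness of the
  ambient universe available.\<close>

lemma decodes_extends:
  assumes "decodes \<pi> E" "decodes \<rho> F" "extends E F" "b \<in> Domain E"
  shows "\<rho> (sing b) = \<pi> b"
proof -
  have "\<forall>b\<in>Domain E. \<pi> b = x \<longrightarrow> \<rho> (sing b) = x" for x
  proof (induction x rule: mem_induct)
    case (step x)
    show ?case
    proof (intro ballI impI)
      fix b assume b: "b \<in> Domain E" "\<pi> b = x"
      have x: "elts x = \<pi> ` {a. (a, b) \<in> E}" using assms(1) b by (auto simp: decodes_def)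
      have "sing b \<in> Domain F" using assms(3) b by (simp add: extends_def)
      then have "elts (\<rho> (sing b)) = \<rho> ` {a. (a, sing b) \<in> F}" using assms(2) by (simp add: decodes_def)
      also have "{a. (a, sing b) \<in> F} = sing ` {a. (a, b) \<in> E}"
        using assms(3) b(1) by (auto simp: extends_def)
      also have "\<rho> ` sing ` {a. (a, b) \<in> E} = \<pi> ` {a. (a, b) \<in> E}"
      proof -
        have "\<rho> (sing a) = \<pi> a" if "(a, b) \<in> E" for a
          using step x that by blast
        then show ?thesis by (simp add: image_image)
      qed
      finally show "\<rho> (sing b) = x" using x extensionality by simp
    qed
  qed
  then show ?thesis using assms(4) by blast
qed

lemma exists_decodes:
  assumes "wf E" "E \<subseteq> M \<times> M" "small M"
  obtains \<pi> where "decodes \<pi> E"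
proof -
  obtain \<pi> where "\<And>b. elts (\<pi> b) = \<pi> ` {a. (a, b) \<in> E}"
    by (rule collapse_exists[OF assms]) (auto intro: that)
  then have "decodes \<pi> E" by (simp add: decodes_def)
  then show ?thesis by (rule that)
qed

text \<open>Membership on \<open>T\<close>, with a top element added, is transported to
  \<open>M\<close> along an injection \<open>c\<close> that sends an already coded set to the
  singleton of its old code.\<close>

lemma exists_extension:
  assumes M: "upclosed M" "M \<noteq> {}"
    and E: "E \<subseteq> M \<times> M" "decodes \<pi> E" "extensional_rel E"
    and T: "trans_class T" "\<pi> ` Domain E \<subseteq> T" "T \<lesssim> M" "small T"
  obtains F \<rho> where "F \<subseteq> M \<times> M" "wf F" "extensional_rel F" "extends E F" "decodes \<rho> F"
    "\<rho> ` Domain F = T"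
proof -
  have infM: "infinite M" using M by (rule upclosed_infinite)
  \<comment> \<open>The top element: \<open>T\<close> as a set. It has every member of
    \<open>T\<close> as a member, so each of them gets into the domain of \<open>F\<close>, while
    \<open>t\<close> itself stays outside.\<close>
  define t where "t = mk T"
  have et: "elts t = T" using T(4) by (simp add: t_def)
  have tT: "t \<notin> T" using et mem_irrefl by metis
  define T' where "T' = insert t T"
  have T'D: "a \<in> T" if "a \<in> elts b" "b \<in> T'" for a b
    using that et T(1) by (auto simp: T'_def trans_class_def)
  have "T' \<lesssim> M"
  proof -
    have "{t} \<lesssim> M" using infM finite_lepoll_infinite[of M "{t}"] by simp
    then have "{t} \<union> T \<lesssim> M" using infM T(3) by (intro lepoll_Un_infinite)
    then show ?thesis by (simp add: T'_def)
  qed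
  then obtain g where g: "inj_on g T'" "g ` T' \<subseteq> M" unfolding lepoll_def by (elim exE conjE)
  have inj\<pi>: "inj_on \<pi> (Domain E)" using E(2,3) by (rule decodes_inj)
  \<comment> \<open>New codes have the two distinct members \<open>sing (g x)\<close> and
    \<open>sing (sing (g x))\<close>, so they differ from all singletons, which are reserved for old
    codes.\<close>
  define c where "c x = (if x \<in> \<pi> ` Domain E then sing (inv_into (Domain E) \<pi> x)
      else up (sing (g x)) (sing (sing (g x))))" for x
  have c\<pi>: "c (\<pi> b) = sing b" if "b \<in> Domain E" for b
    using that inj\<pi> by (simp add: c_def)
  have cnew: "c x = up (sing (g x)) (sing (sing (g x)))" if "x \<notin> \<pi> ` Domain E" for x
    using that by (simp add: c_def)
  have new_not_sing: "up (sing u) (sing (sing u)) \<noteq> sing v" for u v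
  proof
    assume "up (sing u) (sing (sing u)) = sing v"
    then have "elts (up (sing u) (sing (sing u))) = elts (sing v)" by simp
    then have "sing u = sing (sing u)" by auto
    then have "u = sing u" by simp
    then have "u \<in> elts u" by (metis elts_up insertI1)
    then show False by simp
  qed
  have new_inj: "u = v" if eq: "up (sing u) (sing (sing u)) = up (sing v) (sing (sing v))" for u v
  proof -
    have "elts (up (sing u) (sing (sing u))) = elts (up (sing v) (sing (sing v)))" using eq by simp
    then have "sing u = sing v \<or> sing u = sing (sing v) \<and> sing (sing u) = sing v"
      by (simp add: doubleton_eq_iff)
    then have "u = v \<or> u = sing v \<and> sing u = v" by simp
    \<comment> \<open>The crossed matching of the two members would give a membership cycle.\<close>
    moreover have "\<not> (u = sing v \<and> sing u = v)"
    proof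
      assume "u = sing v \<and> sing u = v"
      then have "v \<in> elts u" "u \<in> elts v" using elts_up by (metis insertI1)+
      then show False using mem_asym by blast
    qed
    ultimately show ?thesis by blast
  qed
  have DE: "Domain E \<subseteq> M" using E(1) by auto
  have cM: "c x \<in> M" if "x \<in> T'" for x
  proof (cases "x \<in> \<pi> ` Domain E")
    case True
    then obtain b where "b \<in> Domain E" "x = \<pi> b" by auto
    then show ?thesis using c\<pi> DE M(1) by (auto simp: upclosed_def)
  next
    case False
    have "g x \<in> M" using g(2) that by auto
    then show ?thesis using cnew[OF False] M(1) by (simp add: upclosed_def)
  qed
  have injc: "inj_on c T'"
  proof (rule inj_onI)
    fix x y assume xy: "x \<in> T'" "y \<in> T'" "c x = c y"
    show "x = y"
    proof (cases "x \<in> \<pi> ` Domain E"; cases "y \<in> \<pi> ` Domain E")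
      assume "x \<in> \<pi> ` Domain E" "y \<in> \<pi> ` Domain E"
      then obtain a b where "a \<in> Domain E" "x = \<pi> a" "b \<in> Domain E" "y = \<pi> b" by (elim imageE)
      then show ?thesis using xy(3) c\<pi>[of a] c\<pi>[of b] by simp
    next
      assume "x \<in> \<pi> ` Domain E" "y \<notin> \<pi> ` Domain E"
      then show ?thesis using xy(3) c\<pi> cnew[of y] new_not_sing[of "g y"] by (metis imageE)
    next
      assume "x \<notin> \<pi> ` Domain E" "y \<in> \<pi> ` Domain E"
      then show ?thesis using xy(3) c\<pi> cnew[of x] new_not_sing[of "g x"] by (metis imageE)
    next
      assume "x \<notin> \<pi> ` Domain E" "y \<notin> \<pi> ` Domain E"
      then have "g x = g y" using xy(3) cnew new_inj by metis
      then show ?thesis using g(1) xy by (simp add: inj_on_def)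
    qed
  qed
  define F where "F = {(c a, c b) |a b. b \<in> T' \<and> a \<in> elts b}"
  define \<rho> where "\<rho> = inv_into T' c"
  have \<rho>: "\<rho> (c x) = x" if "x \<in> T'" for x
    using that injc by (simp add: \<rho>_def)
  have TT': "x \<in> T'" if "x \<in> T" for x using that by (simp add: T'_def)
  have F_iff: "(c a, c b) \<in> F \<longleftrightarrow> a \<in> elts b" if "a \<in> T'" "b \<in> T'" for a b
  proof
    assume "(c a, c b) \<in> F"
    then obtain a' b' where ab': "c a = c a'" "c b = c b'" "b' \<in> T'" "a' \<in> elts b'"
      by (auto simp: F_def)
    then have "a' \<in> T'" using T'D TT' by blast
    then have "a = a'" "b = b'" using ab' that injc by (auto simp: inj_on_def)
    then show "a \<in> elts b" using ab' by simp
  qed (use that in \<open>auto simp: F_def\<close>)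
  have F_D: "\<exists>a b. u = c a \<and> v = c b \<and> a \<in> T \<and> b \<in> T' \<and> a \<in> elts b" if "(u, v) \<in> F" for u v
    using that T'D by (auto simp: F_def)
  have DF: "Domain F = c ` T"
  proof (intro equalityI subsetI)
    fix u assume "u \<in> Domain F"
    then show "u \<in> c ` T" using F_D by blast
  next
    fix u assume "u \<in> c ` T"
    then obtain a where "a \<in> T" "u = c a" by auto
    then have "(u, c t) \<in> F" using et by (auto simp: F_def T'_def)
    then show "u \<in> Domain F" by auto
  qed
  show ?thesis
  proof
    show "F \<subseteq> M \<times> M" using F_D cM TT' by (metis SigmaI subrelI)
    \<comment> \<open>Decoding maps \<open>F\<close> into membership, so \<open>F\<close> inherits
      well-foundedness.\<close>
    have "F \<subseteq> inv_image {(y, x). y \<in> elts x} \<rho>"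
    proof (rule subrelI)
      fix u v assume "(u, v) \<in> F"
      then show "(u, v) \<in> inv_image {(y, x). y \<in> elts x} \<rho>"
        using F_D[of u v] \<rho> TT' by auto
    qed
    then show "wf F" using foundation wf_inv_image wf_subset by blast
    show dec: "decodes \<rho> F"
      unfolding decodes_def
    proof
      fix u assume "u \<in> Domain F"
      then obtain b where b: "b \<in> T" "u = c b" using DF by auto
      have "{a. (a, u) \<in> F} = c ` elts b"
      proof (intro equalityI subsetI)
        fix w assume "w \<in> {a. (a, u) \<in> F}"
        then obtain a b' where "w = c a" "c b = c b'" "b' \<in> T'" "a \<in> elts b'"
          using F_D[of w u] b(2) by auto
        moreover then have "b = b'" using injc TT'[OF b(1)] by (simp add: inj_on_def)
        ultimately show "w \<in> c ` elts b" by simp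
      qed (use b TT' in \<open>auto simp: F_def\<close>)
      moreover have "\<rho> (c a) = a" if "a \<in> elts b" for a
        using \<rho> TT' T'D[OF that TT'[OF b(1)]] by simp
      ultimately show "elts (\<rho> u) = \<rho> ` {a. (a, u) \<in> F}"
        using b(2) \<rho>[OF TT'[OF b(1)]] by (simp add: image_image)
    qed
    show "\<rho> ` Domain F = T" using \<rho> TT' by (simp add: DF image_image)
    have injF: "inj_on \<rho> (Domain F)"
      using \<rho> TT' by (auto simp: DF intro!: inj_onI)
    show "extensional_rel F"
      unfolding extensional_rel_def
    proof (intro ballI impI)
      fix u v assume uv: "u \<in> Domain F" "v \<in> Domain F" "\<forall>w. (w, u) \<in> F \<longleftrightarrow> (w, v) \<in> F"
      then have "elts (\<rho> u) = elts (\<rho> v)" using dec by (simp add: decodes_def)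
      then have "\<rho> u = \<rho> v" by (rule extensionality)
      then show "u = v" using injF uv by (simp add: inj_on_def)
    qed
    show "extends E F"
      unfolding extends_def
    proof (intro ballI conjI allI)
      fix b assume b: "b \<in> Domain E"
      then have bT: "\<pi> b \<in> T" using T(2) by auto
      then show "sing b \<in> Domain F" using c\<pi>[OF b] DF by (metis imageI)
      fix a
      have eb: "elts (\<pi> b) = \<pi> ` {a. (a, b) \<in> E}" using E(2) b by (simp add: decodes_def)
      show "(a, sing b) \<in> F \<longleftrightarrow> (\<exists>d. (d, b) \<in> E \<and> a = sing d)"
      proof
        assume "(a, sing b) \<in> F"
        then obtain a' b' where ab': "a = c a'" "sing b = c b'" "b' \<in> T'" "a' \<in> elts b'"
          using F_D by blast
        then have "b' = \<pi> b" using c\<pi>[OF b] injc bT TT' by (auto simp: inj_on_def)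
        then obtain d where "(d, b) \<in> E" "a' = \<pi> d" using ab' eb by auto
        then show "\<exists>d. (d, b) \<in> E \<and> a = sing d" using ab' c\<pi> by (metis Domain.DomainI)
      next
        assume "\<exists>d. (d, b) \<in> E \<and> a = sing d"
        then obtain d where d: "(d, b) \<in> E" "a = sing d" by blast
        then have "\<pi> d \<in> elts (\<pi> b)" "a = c (\<pi> d)" using eb c\<pi>[OF DomainI[OF d(1)]] by auto
        then have "(c (\<pi> d), c (\<pi> b)) \<in> F" using bT TT' by (auto simp only: F_def)
        then show "(a, sing b) \<in> F" using c\<pi>[OF b] \<open>a = c (\<pi> d)\<close> by simp
      qed
    qed
  qed
qed

end

subsection \<open>Coding formulas\<close>

text \<open>The successor of the sum of the arguments exceeds each of them and so is a fresh
  variable; the next formulas choose variables in the same way.\<close>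

definition UpF :: "nat \<Rightarrow> nat \<Rightarrow> nat \<Rightarrow> fm" where
  "UpF z i j = (let w = Suc (z + i + j) in
     Forall w (Iff (Mem w z) (Neg (And (Neg (Eq w i)) (Neg (Eq w j))))))"

definition PairF :: "nat \<Rightarrow> nat \<Rightarrow> nat \<Rightarrow> fm" where
  "PairF z i j = (let s = Suc (z + i + j); t = Suc s in
     Exists s (Exists t (And (UpF s i i) (And (UpF t i j) (UpF z s t)))))"

definition RelF :: "(nat \<Rightarrow> fm) \<Rightarrow> nat \<Rightarrow> nat \<Rightarrow> fm" where
  "RelF P i j = (let z = Suc (i + j) in Exists z (And (PairF z i j) (P z)))"

definition DomF :: "(nat \<Rightarrow> fm) \<Rightarrow> nat \<Rightarrow> fm" where
  "DomF P i = Exists (Suc i) (RelF P i (Suc i))"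

definition extensionalF :: "(nat \<Rightarrow> fm) \<Rightarrow> fm" where
  "extensionalF P = Forall 0 (Forall 1 (Imp (And (DomF P 0) (DomF P 1))
     (Imp (Forall 2 (Iff (RelF P 2 0) (RelF P 2 1))) (Eq 0 1))))"

text \<open>\<open>D\<close> and \<open>R\<close> describe the domain and the relation to be
  extended. They are instantiated once with the membership relation of the structure and once with
  the relation coded by X.\<close>

definition extendsF :: "(nat \<Rightarrow> fm) \<Rightarrow> (nat \<Rightarrow> nat \<Rightarrow> fm) \<Rightarrow> (nat \<Rightarrow> fm) \<Rightarrow> fm" where
  "extendsF D R P = Forall 0 (Imp (D 0) (Forall 1 (Imp (UpF 1 0 0) (And (DomF P 1)
     (Forall 2 (Iff (RelF P 2 1) (Exists 3 (And (R 3 0) (UpF 2 3 3)))))))))"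

definition upclosedF :: fm where
  "upclosedF = Forall 0 (Forall 1 (Exists 2 (UpF 2 0 1)))"

definition foundedXF :: fm where
  "foundedXF = Imp (Exists 0 (InY 0))
     (Exists 0 (And (InY 0) (Forall 1 (Imp (InY 1) (Neg (RelF InX 1 0))))))"

definition set_foundedYF :: fm where
  "set_foundedYF = Forall 2 (Imp (Exists 0 (Mem 0 2))
     (Exists 0 (And (Mem 0 2) (Forall 1 (Imp (Mem 1 2) (Neg (RelF InY 1 0)))))))"

text \<open>Membership becomes the relation coded by Y. Equality can stay, because under an
  extensional well-founded relation distinct codes denote distinct sets.\<close>

primrec codeF :: "fm \<Rightarrow> fm" where
  "codeF (Mem i j) = RelF InY i j"
| "codeF (Eq i j) = Eq i j"
| "codeF (InX i) = InX i"
| "codeF (InY i) = InY i"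
| "codeF (Neg \<phi>) = Neg (codeF \<phi>)"
| "codeF (And \<phi> \<psi>) = And (codeF \<phi>) (codeF \<psi>)"
| "codeF (Forall i \<phi>) = Forall i (codeF \<phi>)"

text \<open>The variable holds not an X-code but its singleton. This is the form that the code takes
  in every Y extending X, so the value can be used directly in \<open>codeF\<close>.\<close>

definition paramF :: "nat \<Rightarrow> fm" where
  "paramF i = Exists (Suc i) (And (DomF InX (Suc i)) (UpF i (Suc i) (Suc i)))"

text \<open>The existential block does not appear: the codes of its witnesses are parameters. They
  remain the same under reflection, whereas the sets they denote depend on the reflected X.\<close>

definition codingF :: "nat \<Rightarrow> nat list \<Rightarrow> fm \<Rightarrow> fm" where
  "codingF n vs \<delta> = foldr (\<lambda>i. And (paramF i)) [0..<n]
     (And upclosedF (And foundedXF (And (extendsF (\<lambda>i. Eq i i) Mem InX) (And (extensionalF InX)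
       (Imp (And (extendsF (DomF InX) (RelF InX) InY) (And (extensionalF InY) set_foundedYF))
         (foldr Forall vs (foldr (\<lambda>v. Imp (DomF InY v)) vs (codeF \<delta>))))))))"

section \<open>The meaning of the coding formulas in a transitive structure\<close>

context zfc_universe
begin

definition set_founded :: "'v set \<Rightarrow> ('v \<times> 'v) set \<Rightarrow> bool" where
  "set_founded M F \<longleftrightarrow> (\<forall>s\<in>M. elts s \<noteq> {} \<longrightarrow> (\<exists>a\<in>elts s. \<forall>b\<in>elts s. (b, a) \<notin> F))"

context
  fixes M X Y :: "'v set"
  assumes trM: "trans_class M" and XM: "X \<subseteq> M" and YM: "Y \<subseteq> M"
begin

lemma sat_UpF: "e z \<in> M \<Longrightarrow> e i \<in> M \<Longrightarrow> e j \<in> M \<Longrightarrow> sat M X Y e (UpF z i j) \<longleftrightarrow> e z = up (e i) (e j)"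
  unfolding eq_up_iff UpF_def Let_def using trans_classD[OF trM, of "e z"] by auto

lemma sat_PairF:
  assumes "e z \<in> M" "e i \<in> M" "e j \<in> M"
  shows "sat M X Y e (PairF z i j) \<longleftrightarrow> e z = pair (e i) (e j)"
proof -
  have "sat M X Y e (PairF z i j) \<longleftrightarrow> (\<exists>s\<in>M. \<exists>t\<in>M. s = sing (e i) \<and> t = up (e i) (e j) \<and> e z = up s t)"
    unfolding PairF_def Let_def sat_Exists sat.simps(6)
    by (intro bex_cong refl) (simp add: sat_UpF assms)
  also have "\<dots> \<longleftrightarrow> e z = pair (e i) (e j)"
    using trans_classD[OF trM, of "e z"] assms(1) by (auto simp: pair_def)
  finally show ?thesis .
qed

lemma sat_RelF_aux:
  assumes "e i \<in> M" "e j \<in> M" "Z \<subseteq> M" "\<And>e z. sat M X Y e (P z) \<longleftrightarrow> e z \<in> Z"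
  shows "sat M X Y e (RelF P i j) \<longleftrightarrow> (e i, e j) \<in> rel Z"
proof -
  have "sat M X Y e (RelF P i j) \<longleftrightarrow> (\<exists>z\<in>M. z = pair (e i) (e j) \<and> z \<in> Z)"
    unfolding RelF_def Let_def sat_Exists sat.simps(6)
    by (intro bex_cong refl) (simp add: sat_PairF assms)
  then show ?thesis using assms(3) by (auto simp: rel_def)
qed

lemma sat_RelF_X: "e i \<in> M \<Longrightarrow> e j \<in> M \<Longrightarrow> sat M X Y e (RelF InX i j) \<longleftrightarrow> (e i, e j) \<in> rel X"
  using XM by (intro sat_RelF_aux) auto

lemma sat_RelF_Y: "e i \<in> M \<Longrightarrow> e j \<in> M \<Longrightarrow> sat M X Y e (RelF InY i j) \<longleftrightarrow> (e i, e j) \<in> rel Y"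
  using YM by (intro sat_RelF_aux) auto

lemma rel_mem: "(a, b) \<in> rel X \<Longrightarrow> a \<in> M \<and> b \<in> M" "(a, b) \<in> rel Y \<Longrightarrow> a \<in> M \<and> b \<in> M"
  using rel_subset[OF trM XM] rel_subset[OF trM YM] by auto

lemma sat_DomF_X: "e i \<in> M \<Longrightarrow> sat M X Y e (DomF InX i) \<longleftrightarrow> e i \<in> Domain (rel X)"
  unfolding DomF_def Domain_iff sat_Exists using rel_mem(1) by (auto simp: sat_RelF_X)

lemma sat_DomF_Y: "e i \<in> M \<Longrightarrow> sat M X Y e (DomF InY i) \<longleftrightarrow> e i \<in> Domain (rel Y)"
  unfolding DomF_def Domain_iff sat_Exists using rel_mem(2) by (auto simp: sat_RelF_Y)

lemmas sat_coding = sat_UpF sat_RelF_X sat_RelF_Y sat_DomF_X sat_DomF_Y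

lemma sat_extensionalF_X: "sat M X Y e (extensionalF InX) \<longleftrightarrow> extensional_rel (rel X)"
proof -
  have "sat M X Y e (extensionalF InX) \<longleftrightarrow> (\<forall>a\<in>M. \<forall>b\<in>M. a \<in> Domain (rel X) \<and> b \<in> Domain (rel X) \<longrightarrow>
      (\<forall>c\<in>M. (c, a) \<in> rel X \<longleftrightarrow> (c, b) \<in> rel X) \<longrightarrow> a = b)"
    unfolding extensionalF_def by (simp add: sat_coding)
  then show ?thesis using rel_mem unfolding extensional_rel_def by (metis DomainE)
qed

lemma sat_extensionalF_Y: "sat M X Y e (extensionalF InY) \<longleftrightarrow> extensional_rel (rel Y)"
proof -
  have "sat M X Y e (extensionalF InY) \<longleftrightarrow> (\<forall>a\<in>M. \<forall>b\<in>M. a \<in> Domain (rel Y) \<and> b \<in> Domain (rel Y) \<longrightarrow>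
      (\<forall>c\<in>M. (c, a) \<in> rel Y \<longleftrightarrow> (c, b) \<in> rel Y) \<longrightarrow> a = b)"
    unfolding extensionalF_def by (simp add: sat_coding)
  then show ?thesis using rel_mem unfolding extensional_rel_def by (metis DomainE)
qed

lemma sat_upclosedF: "sat M X Y e upclosedF \<longleftrightarrow> upclosed M"
  unfolding upclosedF_def upclosed_def by (simp add: sat_coding)

lemma sat_foundedXF:
  "sat M X Y e foundedXF \<longleftrightarrow> (Y \<noteq> {} \<longrightarrow> (\<exists>a\<in>Y. \<forall>b\<in>Y. (b, a) \<notin> rel X))"
proof -
  have "sat M X Y e foundedXF \<longleftrightarrow> ((\<exists>a\<in>M. a \<in> Y) \<longrightarrow> (\<exists>a\<in>M. a \<in> Y \<and> (\<forall>b\<in>M. b \<in> Y \<longrightarrow> (b, a) \<notin> rel X)))"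
    unfolding foundedXF_def by (simp add: sat_coding cong: bex_cong ball_cong)
  then show ?thesis using YM by blast
qed

lemma sat_set_foundedYF: "sat M X Y e set_foundedYF \<longleftrightarrow> set_founded M (rel Y)"
proof -
  have "sat M X Y e set_foundedYF \<longleftrightarrow> (\<forall>s\<in>M. (\<exists>a\<in>M. a \<in> elts s) \<longrightarrow>
      (\<exists>a\<in>M. a \<in> elts s \<and> (\<forall>b\<in>M. b \<in> elts s \<longrightarrow> (b, a) \<notin> rel Y)))"
    unfolding set_foundedYF_def by (simp add: sat_coding cong: bex_cong ball_cong)
  moreover have "a \<in> M" if "s \<in> M" "a \<in> elts s" for a s using trans_classD[OF trM that] .
  ultimately show ?thesis unfolding set_founded_def by blast
qed


lemma sat_extendsF_mem:
  assumes "upclosed M"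
  shows "sat M X Y e (extendsF (\<lambda>i. Eq i i) Mem InX) \<longleftrightarrow> extends (mem_rel M) (rel X)"
proof -
  have "sat M X Y e (extendsF (\<lambda>i. Eq i i) Mem InX) \<longleftrightarrow> (\<forall>b\<in>M. \<forall>s\<in>M. s = sing b \<longrightarrow> s \<in> Domain (rel X) \<and>
      (\<forall>a\<in>M. (a, s) \<in> rel X \<longleftrightarrow> (\<exists>c\<in>M. c \<in> elts b \<and> a = sing c)))"
    unfolding extendsF_def by (simp add: sat_coding cong: bex_cong ball_cong)
  also have "\<dots> \<longleftrightarrow> (\<forall>b\<in>M. sing b \<in> Domain (rel X) \<and>
      (\<forall>a\<in>M. (a, sing b) \<in> rel X \<longleftrightarrow> (\<exists>c\<in>M. c \<in> elts b \<and> a = sing c)))"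
    using assms by (auto simp: upclosed_def)
  also have "\<dots> \<longleftrightarrow> extends (mem_rel M) (rel X)"
    unfolding extends_def Domain_mem_rel[OF assms]
  proof (intro ball_cong refl conj_cong)
    fix b assume "b \<in> M"
    then have "(c, b) \<in> mem_rel M \<longleftrightarrow> c \<in> M \<and> c \<in> elts b" for c by (simp add: mem_rel_def)
    moreover have "a \<in> M" if "(a, sing b) \<in> rel X \<or> (\<exists>c\<in>M. c \<in> elts b \<and> a = sing c)" for a
      using that rel_mem(1) assms by (auto simp: upclosed_def)
    ultimately show "(\<forall>a\<in>M. (a, sing b) \<in> rel X \<longleftrightarrow> (\<exists>c\<in>M. c \<in> elts b \<and> a = sing c)) \<longleftrightarrow>
        (\<forall>a. (a, sing b) \<in> rel X \<longleftrightarrow> (\<exists>c. (c, b) \<in> mem_rel M \<and> a = sing c))"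
      by blast
  qed
  finally show ?thesis .
qed

lemma sat_extendsF_rel:
  assumes "upclosed M"
  shows "sat M X Y e (extendsF (DomF InX) (RelF InX) InY) \<longleftrightarrow> extends (rel X) (rel Y)"
proof -
  have "sat M X Y e (extendsF (DomF InX) (RelF InX) InY) \<longleftrightarrow> (\<forall>b\<in>M. b \<in> Domain (rel X) \<longrightarrow>
      (\<forall>s\<in>M. s = sing b \<longrightarrow> s \<in> Domain (rel Y) \<and>
      (\<forall>a\<in>M. (a, s) \<in> rel Y \<longleftrightarrow> (\<exists>c\<in>M. (c, b) \<in> rel X \<and> a = sing c))))"
    unfolding extendsF_def by (simp add: sat_coding cong: bex_cong ball_cong)
  also have "\<dots> \<longleftrightarrow> (\<forall>b\<in>M. b \<in> Domain (rel X) \<longrightarrow> sing b \<in> Domain (rel Y) \<and>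
      (\<forall>a\<in>M. (a, sing b) \<in> rel Y \<longleftrightarrow> (\<exists>c\<in>M. (c, b) \<in> rel X \<and> a = sing c)))"
    using assms by (auto simp: upclosed_def)
  also have "\<dots> \<longleftrightarrow> (\<forall>b\<in>Domain (rel X). sing b \<in> Domain (rel Y) \<and>
      (\<forall>a\<in>M. (a, sing b) \<in> rel Y \<longleftrightarrow> (\<exists>c\<in>M. (c, b) \<in> rel X \<and> a = sing c)))"
  proof -
    have "Domain (rel X) \<subseteq> M" using rel_mem(1) by auto
    then show ?thesis by (auto simp only: Ball_def)
  qed
  also have "\<dots> \<longleftrightarrow> extends (rel X) (rel Y)"
    unfolding extends_def
  proof (intro ball_cong refl conj_cong)
    fix b
    have "a \<in> M" if "(a, sing b) \<in> rel Y \<or> (\<exists>c\<in>M. (c, b) \<in> rel X \<and> a = sing c)" for a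
      using that rel_mem(2) assms by (auto simp: upclosed_def)
    moreover have "c \<in> M" if "(c, b) \<in> rel X" for c using that rel_mem(1) by blast
    ultimately show "(\<forall>a\<in>M. (a, sing b) \<in> rel Y \<longleftrightarrow> (\<exists>c\<in>M. (c, b) \<in> rel X \<and> a = sing c)) \<longleftrightarrow>
        (\<forall>a. (a, sing b) \<in> rel Y \<longleftrightarrow> (\<exists>c. (c, b) \<in> rel X \<and> a = sing c))"
      by blast
  qed
  finally show ?thesis .
qed

text \<open>Induction over bounded formulas: the members of \<open>\<rho> (g j)\<close> are exactly
  the values at predecessors of \<open>g j\<close>, and injectivity of \<rho> turns statements about
  values back into statements about codes.\<close>

lemma sat_codeF:
  assumes "\<delta> \<in> Delta0" "vars_below n \<delta>" "decodes \<rho> (rel Y)" "inj_on \<rho> (Domain (rel Y))"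
    "range g \<subseteq> M" "\<And>i. i < n \<Longrightarrow> g i \<in> Domain (rel Y)"
  shows "sat M X Y g (codeF \<delta>) \<longleftrightarrow> true (\<rho> \<circ> g) \<delta>"
  using assms(1,2,5,6)
proof (induction \<delta> arbitrary: g rule: Delta0.induct)
  case (1 i j)
  have D: "g i \<in> Domain (rel Y)" "g j \<in> Domain (rel Y)" and M: "g i \<in> M" "g j \<in> M"
    using 1 by auto
  have "\<rho> (g i) \<in> \<rho> ` {a. (a, g j) \<in> rel Y} \<longleftrightarrow> (g i, g j) \<in> rel Y"
  proof
    assume "\<rho> (g i) \<in> \<rho> ` {a. (a, g j) \<in> rel Y}"
    then obtain a where a: "(a, g j) \<in> rel Y" "\<rho> (g i) = \<rho> a" by auto
    then have "g i = a" using inj_onD[OF assms(4) a(2) D(1)] by blast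
    then show "(g i, g j) \<in> rel Y" using a by simp
  qed auto
  then show ?case using assms(3) D(2) M by (simp add: sat_RelF_Y decodes_def)
next
  case (2 i j)
  have "g i \<in> Domain (rel Y)" "g j \<in> Domain (rel Y)" using 2 by auto
  then show ?case using inj_on_eq_iff[OF assms(4)] by simp
next
  case (5 \<phi> i j)
  have j: "g j \<in> Domain (rel Y)" and i: "g j \<in> M" and vb: "vars_below n \<phi>"
    using "5.prems" by (auto simp: Imp_def)
  have IH: "sat M X Y (g(i := a)) (codeF \<phi>) \<longleftrightarrow> true ((\<rho> \<circ> g)(i := \<rho> a)) \<phi>" if a: "(a, g j) \<in> rel Y" for a
  proof -
    have "(\<rho> \<circ> g)(i := \<rho> a) = \<rho> \<circ> g(i := a)" by auto
    moreover have "range (g(i := a)) \<subseteq> M" using "5.prems"(2) rel_mem(2)[OF a] by auto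
    moreover have "(g(i := a)) k \<in> Domain (rel Y)" if "k < n" for k
      using "5.prems"(3)[OF that] a by auto
    ultimately show ?thesis using "5.IH"[OF vb] by (simp only:)
  qed
  have "sat M X Y g (codeF (Forall i (Imp (Mem i j) \<phi>))) \<longleftrightarrow>
      (\<forall>a\<in>M. (a, g j) \<in> rel Y \<longrightarrow> sat M X Y (g(i := a)) (codeF \<phi>))"
    using i "5.hyps"(2) by (simp add: Imp_def sat_RelF_Y cong: ball_cong)
  also have "\<dots> \<longleftrightarrow> (\<forall>a\<in>{a. (a, g j) \<in> rel Y}. true ((\<rho> \<circ> g)(i := \<rho> a)) \<phi>)"
    using IH rel_mem(2) by blast
  also have "\<dots> \<longleftrightarrow> (\<forall>x\<in>\<rho> ` {a. (a, g j) \<in> rel Y}. true ((\<rho> \<circ> g)(i := x)) \<phi>)"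
    by blast
  also have "\<rho> ` {a. (a, g j) \<in> rel Y} = elts ((\<rho> \<circ> g) j)"
    using assms(3) j by (simp add: decodes_def)
  finally show ?case unfolding BAll_def[symmetric] true_BAll[OF "5.hyps"(2)] .
qed auto

lemma sat_paramF: "e i \<in> M \<Longrightarrow> sat M X Y e (paramF i) \<longleftrightarrow> (\<exists>c\<in>Domain (rel X). e i = sing c)"
proof -
  assume "e i \<in> M"
  then have "sat M X Y e (paramF i) \<longleftrightarrow> (\<exists>c\<in>M. c \<in> Domain (rel X) \<and> e i = sing c)"
    unfolding paramF_def by (simp add: sat_coding cong: bex_cong)
  then show ?thesis using rel_mem(1) by (metis DomainE)
qed

lemma sat_foldr_And: "sat M X Y e (foldr (\<lambda>i. And (P i)) ks \<phi>) \<longleftrightarrow> (\<forall>i\<in>set ks. sat M X Y e (P i)) \<and> sat M X Y e \<phi>"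
  by (induction ks) auto

lemma sat_foldr_Imp: "sat M X Y e (foldr (\<lambda>i. Imp (P i)) ks \<phi>) \<longleftrightarrow> ((\<forall>i\<in>set ks. sat M X Y e (P i)) \<longrightarrow> sat M X Y e \<phi>)"
  by (induction ks) auto

lemma sat_codingF:
  assumes d: "range d \<subseteq> M"
  shows "sat M X Y d (codingF n vs \<delta>) \<longleftrightarrow>
    (\<forall>i<n. \<exists>c\<in>Domain (rel X). d i = sing c) \<and> upclosed M \<and>
    (Y \<noteq> {} \<longrightarrow> (\<exists>a\<in>Y. \<forall>b\<in>Y. (b, a) \<notin> rel X)) \<and>
    extends (mem_rel M) (rel X) \<and> extensional_rel (rel X) \<and>
    (extends (rel X) (rel Y) \<and> extensional_rel (rel Y) \<and> set_founded M (rel Y) \<longrightarrow>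
      (\<forall>g. upd (set vs) M d g \<longrightarrow> (\<forall>v\<in>set vs. g v \<in> Domain (rel Y)) \<longrightarrow> sat M X Y g (codeF \<delta>)))"
proof -
  have "(\<forall>i\<in>set [0..<n]. sat M X Y d (paramF i)) \<longleftrightarrow> (\<forall>i<n. \<exists>c\<in>Domain (rel X). d i = sing c)"
  proof -
    have "d i \<in> M" for i using d by auto
    then show ?thesis by (simp add: sat_paramF Ball_def)
  qed
  moreover have "(\<forall>v\<in>set vs. sat M X Y g (DomF InY v)) \<longleftrightarrow> (\<forall>v\<in>set vs. g v \<in> Domain (rel Y))"
    if "upd (set vs) M d g" for g
  proof -
    have "g v \<in> M" for v using upd_range[OF that d] by auto
    then show ?thesis by (simp add: sat_DomF_Y)
  qed
  ultimately show ?thesis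
    unfolding codingF_def sat_foldr_And sat.simps(6) sat_Imp sat_foldr_Forall sat_foldr_Imp
      sat_upclosedF sat_foundedXF sat_extensionalF_X sat_extensionalF_Y sat_set_foundedYF
    by (simp add: sat_extendsF_mem sat_extendsF_rel cong: conj_cong imp_cong)
qed

end

end

subsection \<open>Elementarity from reflection\<close>

text \<open>Reflection allows one parameter, so several are packed into a nested pair. Variable
  \<open>n + k\<close> holds the remaining tuple; its head is put into variable \<open>k\<close> and
  its tail into the next variable \<open>Suc (n + k)\<close>.\<close>

definition tupleF :: "nat \<Rightarrow> nat list \<Rightarrow> fm \<Rightarrow> fm" where
  "tupleF n ks \<Phi> = foldr (\<lambda>k \<phi>. Exists k (Exists (Suc (n + k))
     (And (PairF (n + k) k (Suc (n + k))) \<phi>))) ks \<Phi>"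

context zfc_universe
begin

definition tuple :: "(nat \<Rightarrow> 'v) \<Rightarrow> nat list \<Rightarrow> 'v" where
  "tuple d ks = foldr (\<lambda>k. pair (d k)) ks (mk {})"

lemma pair_memD:
  assumes "trans_class M" "pair a b \<in> M"
  shows "a \<in> M" "b \<in> M"
proof -
  have "up a b \<in> elts (pair a b)" by (simp add: pair_def)
  then have "up a b \<in> M" using assms trans_classD by blast
  then show "a \<in> M" "b \<in> M" using trans_classD[OF assms(1), of "up a b"] by auto
qed

lemma tuple_memD: "trans_class M \<Longrightarrow> tuple d ks \<in> M \<Longrightarrow> k \<in> set ks \<Longrightarrow> d k \<in> M"
  by (induction ks) (auto simp: tuple_def dest: pair_memD)

lemma tuple_mem: "upclosed M \<Longrightarrow> mk {} \<in> M \<Longrightarrow> range d \<subseteq> M \<Longrightarrow> tuple d ks \<in> M"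
  by (induction ks) (auto simp: tuple_def intro!: upclosed_pair)

lemma sat_tupleF:
  assumes M: "trans_class M" "X \<subseteq> M" "Y \<subseteq> M" and \<Phi>: "vars_below n \<Phi>"
    and "k \<le> n" "range e \<subseteq> M" "e (n + k) = tuple d [k..<n]" "\<And>i. i < k \<Longrightarrow> e i = d i"
  shows "sat M X Y e (tupleF n [k..<n] \<Phi>) \<longleftrightarrow> sat M X Y d \<Phi>"
  using assms(5-)
proof (induction k arbitrary: e rule: inc_induct)
  case base
  then show ?case using sat_cong[OF \<Phi>, of e d] by (simp add: tupleF_def)
next
  case (step k)
  have ks: "[k..<n] = k # [Suc k..<n]" using step.hyps by (simp add: upt_conv_Cons)
  define q where "q = tuple d [Suc k..<n]"
  have ek: "e (n + k) = pair (d k) q" using step.prems(2) by (simp add: ks tuple_def q_def)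
  then have mem: "pair (d k) q \<in> M" using step.prems(1) by (metis range_subsetD)
  have M': "d k \<in> M" "q \<in> M" using pair_memD[OF M(1) mem] by auto
  let ?e = "\<lambda>a b. e(k := a, Suc (n + k) := b)"
  have kn: "k < n" using step.hyps by simp
  have pair: "sat M X Y (?e a b) (PairF (n + k) k (Suc (n + k))) \<longleftrightarrow> pair (d k) q = pair a b"
    if "a \<in> M" "b \<in> M" for a b
  proof -
    have "?e a b (n + k) = pair (d k) q" "?e a b k = a" "?e a b (Suc (n + k)) = b" using ek kn by auto
    then show ?thesis using sat_PairF[OF M, of "?e a b" "n + k" k "Suc (n + k)"] that mem by simp
  qed
  have "sat M X Y e (tupleF n [k..<n] \<Phi>) \<longleftrightarrow>
      (\<exists>a\<in>M. \<exists>b\<in>M. sat M X Y (?e a b) (PairF (n + k) k (Suc (n + k))) \<and>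
        sat M X Y (?e a b) (tupleF n [Suc k..<n] \<Phi>))"
    by (simp add: tupleF_def ks del: fun_upd_apply)
  \<comment> \<open>Injectivity of pairing leaves \<open>d k\<close> and \<open>q\<close> as the
    only choice, and both are in \<open>M\<close> by transitivity.\<close>
  also have "\<dots> \<longleftrightarrow> sat M X Y (?e (d k) q) (tupleF n [Suc k..<n] \<Phi>)"
    using pair M' by auto
  also have "\<dots> \<longleftrightarrow> sat M X Y d \<Phi>"
  proof (rule step.IH)
    show "range (?e (d k) q) \<subseteq> M" using step.prems(1) M' by auto
    show "?e (d k) q (n + Suc k) = tuple d [Suc k..<n]" by (simp add: q_def)
    show "?e (d k) q i = d i" if "i < Suc k" for i
      using that step.prems(3)[of i] kn by (cases "i = k") auto
  qed
  finally show ?case .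
qed

lemma wf_rel_if_subset_minimal:
  fixes R :: "('v \<times> 'v) set"
  assumes "R \<subseteq> M \<times> M" "\<And>Y. Y \<subseteq> M \<Longrightarrow> Y \<noteq> {} \<Longrightarrow> \<exists>a\<in>Y. \<forall>b\<in>Y. (b, a) \<notin> R"
  shows "wf R"
proof (rule wfI_min)
  fix x :: 'v and Q :: "'v set"
  assume "x \<in> Q"
  show "\<exists>z\<in>Q. \<forall>y. (y, z) \<in> R \<longrightarrow> y \<notin> Q"
  proof (cases "Q \<inter> M = {}")
    case True
    then show ?thesis using assms(1) \<open>x \<in> Q\<close> by blast
  next
    case False
    then obtain a where "a \<in> Q \<inter> M" "\<forall>b\<in>Q \<inter> M. (b, a) \<notin> R" using assms(2)[of "Q \<inter> M"] by auto
    then show ?thesis using assms(1) by (intro bexI[of _ a]) auto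
  qed
qed

lemma wf_set_founded: "wf R \<Longrightarrow> set_founded M R"
  unfolding set_founded_def by (metis wfE_min all_not_in_conv)

end

section \<open>Reflection with several parameters and preservation of \<Sigma>_2 statements\<close>

context inaccessible_cardinal
begin

lemma upclosed_V_\<kappa>: "upclosed (V \<kappa>)"
  unfolding upclosed_def up_def by (intro ballI mk_mem_V_\<kappa> countable_lesspoll_\<kappa>) auto

text \<open>The range of an infinite descending chain is countable, hence an element of
  \<open>V \<kappa>\<close>, and it would have no minimal element.\<close>

lemma set_founded_wf:
  assumes "R \<subseteq> V \<kappa> \<times> V \<kappa>" "set_founded (V \<kappa>) R"
  shows "wf R"
  unfolding wf_iff_no_infinite_down_chain
proof
  assume "\<exists>s. \<forall>i. (s (Suc i), s i) \<in> R"
  then obtain s where s: "\<And>i. (s (Suc i), s i) \<in> R" by blast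
  have "range s \<subseteq> V \<kappa>" using s assms(1) by blast
  moreover have "range s \<prec> elts \<kappa>" by (rule countable_lesspoll_\<kappa>) simp
  ultimately have "mk (range s) \<in> V \<kappa>" "small (range s)"
    using mk_mem_V_\<kappa> small_subset[OF small_V] by auto
  then obtain a where "a \<in> range s" "\<forall>b\<in>range s. (b, a) \<notin> R"
    using assms(2) unfolding set_founded_def by fastforce
  then show False using s by auto
qed

lemma reflection_parameters:
  assumes refl: "Sigma12_reflection \<kappa>" and \<Phi>: "vars_below n \<Phi>" and d: "range d \<subseteq> V \<kappa>"
    and X: "X \<subseteq> V \<kappa>" "\<And>Y. Y \<subseteq> V \<kappa> \<Longrightarrow> sat (V \<kappa>) X Y d \<Phi>"
  obtains \<xi> X' where "\<xi> \<in> elts \<kappa>" "V \<xi> \<noteq> {}" "\<And>i. i < n \<Longrightarrow> d i \<in> V \<xi>" "X' \<subseteq> V \<xi>"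
    "\<And>Y. Y \<subseteq> V \<xi> \<Longrightarrow> sat (V \<xi>) X' Y d \<Phi>"
proof -
  define p where "p = tuple d [0..<n]"
  have "mk {} \<in> V \<kappa>" by (intro mk_mem_V_\<kappa> countable_lesspoll_\<kappa>) auto
  then have p: "p \<in> V \<kappa>" unfolding p_def using d by (intro tuple_mem upclosed_V_\<kappa>)
  have eq: "sat (V \<alpha>) X Y (\<lambda>_. p) (tupleF n [0..<n] \<Phi>) \<longleftrightarrow> sat (V \<alpha>) X Y d \<Phi>"
    if "X \<subseteq> V \<alpha>" "Y \<subseteq> V \<alpha>" "p \<in> V \<alpha>" for X Y \<alpha>
    using that by (intro sat_tupleF trans_class_V \<Phi>) (auto simp: p_def)
  have "sat_Sigma12 (V \<kappa>) (tupleF n [0..<n] \<Phi>) p"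
    unfolding sat_Sigma12_def using X eq[OF X(1) _ p] by blast
  then obtain \<xi> where \<xi>: "\<xi> \<in> elts \<kappa>" "p \<in> V \<xi>" "sat_Sigma12 (V \<xi>) (tupleF n [0..<n] \<Phi>) p"
    using refl p unfolding Sigma12_reflection_def by blast
  then obtain X' where X': "X' \<subseteq> V \<xi>" "\<And>Y. Y \<subseteq> V \<xi> \<Longrightarrow> sat (V \<xi>) X' Y (\<lambda>_. p) (tupleF n [0..<n] \<Phi>)"
    unfolding sat_Sigma12_def by blast
  show ?thesis
  proof
    show "d i \<in> V \<xi>" if "i < n" for i
      using tuple_memD[OF trans_class_V, of d "[0..<n]" \<xi> i] \<xi>(2) that by (simp add: p_def)
    show "sat (V \<xi>) X' Y d \<Phi>" if "Y \<subseteq> V \<xi>" for Y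
      using X'(2)[OF that] eq[OF X'(1) that \<xi>(2)] by blast
  qed (use \<xi> X' in auto)
qed

lemma Sigma2_downward:
  assumes refl: "Sigma12_reflection \<kappa>" and \<delta>: "\<delta> \<in> Delta0" and e: "range e \<subseteq> V \<kappa>"
    and f: "upd (set us) (H (card_succ \<kappa>)) e f"
    and true: "\<And>g. upd (set vs) (H (card_succ \<kappa>)) f g \<Longrightarrow> true g \<delta>"
  obtains f' where "upd (set us) (V \<kappa>) e f'" "\<And>g. upd (set vs) (V \<kappa>) f' g \<Longrightarrow> true g \<delta>"
proof -
  note up\<kappa> = upclosed_V_\<kappa>
  have ne: "V \<kappa> \<noteq> {}" using infinite_V_\<kappa> by auto
  \<comment> \<open>The sums bound every index in the quantifier blocks, so \<open>n\<close> exceeds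
    all variables in play.\<close>
  obtain n where n: "vars_below n \<delta>" "n \<ge> Suc (sum_list us + sum_list vs)"
    using exists_vars_below by blast
  have n_us: "i < n" if "i \<in> set us" for i
    using n(2) member_le_sum_list[OF that] by simp
  have n_vs: "i < n" if "i \<in> set vs" for i
    using n(2) member_le_sum_list[OF that] by simp
  have fH: "range f \<subseteq> H (card_succ \<kappa>)" using f subset_trans[OF e V_\<kappa>_subset_H_card_succ] by (rule upd_range)
  \<comment> \<open>A transitive set containing all witnesses and all of \<open>V \<kappa>\<close>,
    yet no larger than \<open>V \<kappa>\<close>, so it has a code \<open>F\<close> on
    \<open>V \<kappa>\<close>.\<close>
  define T where "T = V \<kappa> \<union> (\<Union>i. {f i} \<union> tc (f i))"
  have trT: "trans_class T"
    unfolding T_def insert_is_Un[symmetric]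
    by (intro trans_class_Un trans_class_UN trans_class_V trans_class_insert_tc)
  have TV: "T \<lesssim> V \<kappa>"
  proof -
    have "{f i} \<union> tc (f i) \<lesssim> V \<kappa>" for i
    proof (rule lepoll_Un_infinite[OF infinite_V_\<kappa>])
      have "tc (f i) \<lesssim> elts \<kappa>" using fH H_card_succ[OF card_\<kappa>] by auto
      then show "tc (f i) \<lesssim> V \<kappa>" using \<kappa>_lepoll_V by (rule lepoll_trans)
      show "{f i} \<lesssim> V \<kappa>" by (rule countable_lepoll_infinite[OF _ infinite_V_\<kappa>]) simp
    qed
    then have "(\<Union>i. {f i} \<union> tc (f i)) \<lesssim> V \<kappa>" by (rule lepoll_UN_nat[OF infinite_V_\<kappa>])
    then show ?thesis
      unfolding T_def by (rule lepoll_Un_infinite[OF infinite_V_\<kappa> lepoll_refl])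
  qed
  have smT: "small T" using small_V TV by (rule small_lepoll)
  note D\<kappa> = Domain_mem_rel[OF up\<kappa>]
  have mV: "mem_rel (V \<kappa>) \<subseteq> V \<kappa> \<times> V \<kappa>" by (auto simp: mem_rel_def)
  have VT: "id ` Domain (mem_rel (V \<kappa>)) \<subseteq> T" by (simp add: D\<kappa> T_def)
  obtain F \<rho> where F: "F \<subseteq> V \<kappa> \<times> V \<kappa>" "wf F" "extensional_rel F" "extends (mem_rel (V \<kappa>)) F"
    "decodes \<rho> F" "\<rho> ` Domain F = T"
    using exists_extension[OF up\<kappa> ne mV decodes_mem_rel[OF trans_class_V]
        extensional_mem_rel[OF trans_class_V] trT VT TV smT] .
  have inj\<rho>: "inj_on \<rho> (Domain F)" using F(5,3) by (rule decodes_inj)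
  obtain X where X: "X \<subseteq> V \<kappa>" "rel X = F" using exists_rel[OF up\<kappa> F(1)] .
  have "\<exists>c. c \<in> Domain F \<and> \<rho> c = f i" for i
  proof -
    have "f i \<in> \<rho> ` Domain F" unfolding F(6) by (auto simp: T_def)
    then show ?thesis by auto
  qed
  then obtain c where c: "\<And>i. c i \<in> Domain F" "\<And>i. \<rho> (c i) = f i" by metis
  have cV: "c i \<in> V \<kappa>" for i using c(1)[of i] F(1) by auto
  \<comment> \<open>A parameter in \<open>V \<kappa>\<close> has a code determined by the parameter
    itself; this will recover it after reflection.\<close>
  have c_sing: "c i = sing (f i)" if "f i \<in> V \<kappa>" for i
  proof -
    have D: "f i \<in> Domain (mem_rel (V \<kappa>))" using that D\<kappa> by simp
    then have "\<rho> (sing (f i)) = f i"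
      using decodes_extends[OF decodes_mem_rel[OF trans_class_V] F(5,4)] by simp
    moreover have "sing (f i) \<in> Domain F" using F(4) D by (simp add: extends_def)
    ultimately show ?thesis using inj\<rho> c[of i] by (metis inj_onD)
  qed
  define d where "d i = sing (c i)" for i
  have dV: "range d \<subseteq> V \<kappa>" using up\<kappa> cV by (auto simp: d_def upclosed_def)
  \<comment> \<open>In \<open>V \<kappa>\<close> the first-order foundation condition on
    \<open>Y\<close> yields true well-foundedness. So \<open>Y\<close> decodes to a transitive set
    of size at most \<kappa>, whose elements lie in the larger structure, where \<delta> is
    assumed.\<close>
  have holds: "sat (V \<kappa>) X Y d (codingF n vs \<delta>)" if Y: "Y \<subseteq> V \<kappa>" for Y
    unfolding sat_codingF[OF trans_class_V X(1) Y dV] X(2)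
  proof (intro conjI allI impI)
    fix i show "\<exists>c\<in>Domain F. d i = sing c" using c(1) by (auto simp: d_def)
  next
    assume "Y \<noteq> {}"
    then show "\<exists>a\<in>Y. \<forall>b\<in>Y. (b, a) \<notin> F" using F(2) by (metis wfE_min all_not_in_conv)
  next
    fix g
    assume hyp: "extends F (rel Y) \<and> extensional_rel (rel Y) \<and> set_founded (V \<kappa>) (rel Y)"
      and g: "upd (set vs) (V \<kappa>) d g" "\<forall>v\<in>set vs. g v \<in> Domain (rel Y)"
    have RY: "rel Y \<subseteq> V \<kappa> \<times> V \<kappa>" using trans_class_V Y by (rule rel_subset)
    then have "wf (rel Y)" using hyp set_founded_wf by blast
    then obtain \<sigma> where \<sigma>: "decodes \<sigma> (rel Y)" using exists_decodes[OF _ RY small_V] by blast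
    have inj\<sigma>: "inj_on \<sigma> (Domain (rel Y))" using \<sigma> hyp decodes_inj by blast
    have gi: "g i = sing (c i)" if "i \<notin> set vs" for i using g(1) that by (simp add: upd_def d_def)
    have gD: "g i \<in> Domain (rel Y)" for i
    proof (cases "i \<in> set vs")
      case False
      then show ?thesis using gi hyp c(1) by (simp add: extends_def)
    qed (use g(2) in simp)
    define h where "h i = (if i \<in> set vs then \<sigma> (g i) else f i)" for i
    have "\<sigma> ` Domain (rel Y) \<lesssim> elts \<kappa>"
    proof -
      have "Domain (rel Y) \<subseteq> V \<kappa>" using RY by auto
      then have "Domain (rel Y) \<lesssim> elts \<kappa>"
        using V_\<kappa>_lepoll subset_imp_lepoll lepoll_trans by blast
      then show ?thesis using image_lepoll lepoll_trans by blast
    qed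
    then have "\<sigma> (g i) \<in> H (card_succ \<kappa>)" for i
      using decodes_trans_class[OF \<sigma>] gD[of i]
      by (intro mem_H_card_succI[OF card_\<kappa> decodes_trans_class[OF \<sigma>]]) (auto simp: trans_class_def)
    then have "upd (set vs) (H (card_succ \<kappa>)) f h" by (simp add: upd_def h_def)
    then have "true h \<delta>" by (rule true)
    moreover have "true (\<sigma> \<circ> g) \<delta> \<longleftrightarrow> true h \<delta>"
    proof (rule sat_cong[OF n(1)])
      fix i
      show "(\<sigma> \<circ> g) i = h i"
        using decodes_extends[OF F(5) \<sigma> _ c(1)[of i]] hyp gi[of i] c(2) by (simp add: h_def)
    qed
    ultimately show "sat (V \<kappa>) X Y g (codeF \<delta>)"
      using sat_codeF[OF trans_class_V X(1) Y \<delta> n(1) \<sigma> inj\<sigma> upd_range[OF g(1) dV] gD] by blast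
  qed (use up\<kappa> F in simp_all)
  obtain k where k: "k \<ge> n" "vars_below k (codingF n vs \<delta>)" using exists_vars_below by blast
  obtain \<xi> X' where \<xi>: "\<xi> \<in> elts \<kappa>" "V \<xi> \<noteq> {}" and d\<xi>: "\<And>i. i < k \<Longrightarrow> d i \<in> V \<xi>" and X': "X' \<subseteq> V \<xi>"
    and sat: "\<And>Y. Y \<subseteq> V \<xi> \<Longrightarrow> sat (V \<xi>) X' Y d (codingF n vs \<delta>)"
    using reflection_parameters[OF refl k(2) dV X(1) holds] by metis
  obtain z where z: "z \<in> V \<xi>" using \<xi>(2) by auto
  \<comment> \<open>Reflection places only the first \<open>k\<close> values in
    \<open>V \<xi>\<close>; the remaining ones get a default there, which the formula does not
    see.\<close>
  define d' where "d' i = (if i < k then d i else z)" for i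
  have d'V: "range d' \<subseteq> V \<xi>" using d\<xi> z by (auto simp: d'_def)
  have d'c: "d' i = sing (c i)" if "i < n" for i using that k(1) by (simp add: d'_def d_def)
  have sat': "sat (V \<xi>) X' Y d' (codingF n vs \<delta>)" if "Y \<subseteq> V \<xi>" for Y
    using sat[OF that] sat_cong[OF k(2), of d d'] by (simp add: d'_def)
  note coded = iffD1[OF sat_codingF[OF trans_class_V X' _ d'V] sat']
  define E where "E = rel X'"
  have EV: "E \<subseteq> V \<xi> \<times> V \<xi>" unfolding E_def using trans_class_V X' by (rule rel_subset)
  have up\<xi>: "upclosed (V \<xi>)" and extE: "extends (mem_rel (V \<xi>)) E" and exE: "extensional_rel E"
    and par: "\<forall>i<n. \<exists>c\<in>Domain E. d' i = sing c"
    using coded[of "{}"] unfolding E_def by auto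
  \<comment> \<open>The foundation clause for X holds for every \<open>Y\<close>, so each nonempty
    subset of \<open>V \<xi>\<close> has a minimal element.\<close>
  have wfE: "wf E"
    by (rule wf_rel_if_subset_minimal[OF EV]) (use coded in \<open>simp add: E_def\<close>)
  obtain \<pi> where \<pi>: "decodes \<pi> E" using exists_decodes[OF wfE EV small_V] .
  have cE: "c i \<in> Domain E" if "i < n" for i
    using par that d'c[OF that] by (metis sing_eq_iff)
  \<comment> \<open>The new witnesses are what the old codes denote under the reflected
    relation.\<close>
  define f' where "f' i = (if i \<in> set us then \<pi> (c i) else e i)" for i
  have \<pi>c: "\<pi> (c i) = f' i" if "i < n" for i
  proof (cases "i \<in> set us")
    case False
    then have fe: "f i = e i" "f i \<in> V \<kappa>" using f e by (auto simp: upd_def)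
    then have "d' i = sing (sing (e i))" using c_sing[of i] d'c[OF that] by simp
    \<comment> \<open>By transitivity \<open>e i\<close> itself is in \<open>V \<xi>\<close>. Since
      \<open>E\<close> extends membership on \<open>V \<xi>\<close>, its code
      \<open>sing (e i)\<close> still denotes \<open>e i\<close>.\<close>
    then have "sing (sing (e i)) \<in> V \<xi>" using d'V by (metis range_subsetD)
    then have "e i \<in> V \<xi>" using trans_classD[OF trans_class_V] elts_up by (metis insertI1)
    then have "\<pi> (sing (e i)) = e i"
      using decodes_extends[OF decodes_mem_rel[OF trans_class_V] \<pi> extE] Domain_mem_rel[OF up\<xi>] by simp
    then show ?thesis using False fe c_sing[of i] by (simp add: f'_def)
  qed (simp add: f'_def)
  define S where "S = \<pi> ` Domain E"
  have trS: "trans_class S" unfolding S_def using \<pi> by (rule decodes_trans_class)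
  have SV: "S \<lesssim> V \<xi>"
  proof -
    have "Domain E \<subseteq> V \<xi>" using EV by auto
    then show ?thesis unfolding S_def using image_lepoll subset_imp_lepoll lepoll_trans by blast
  qed
  \<comment> \<open>The decoded set is no larger than \<open>V \<xi>\<close>, so its elements are
    hereditarily smaller than \<kappa>.\<close>
  have S\<kappa>: "x \<in> V \<kappa>" if "x \<in> S" for x
  proof -
    have "tc x \<subseteq> S" using that trS by (intro tc_least) (auto simp: trans_class_def)
    then have "tc x \<lesssim> V \<xi>" using SV by (rule lepoll_trans[OF subset_imp_lepoll])
    then have "tc x \<prec> elts \<kappa>" using V_lesspoll_\<kappa>[OF \<xi>(1)] by (rule lesspoll_trans1)
    then show ?thesis unfolding H_\<kappa>_eq_V[symmetric] by (simp add: H_def)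
  qed
  have f'S: "f' i \<in> S" if "i < n" for i
    using cE[OF that] \<pi>c[OF that] unfolding S_def by (metis imageI)
  show ?thesis
  proof
    show "upd (set us) (V \<kappa>) e f'"
    proof -
      have "f' i \<in> V \<kappa>" if "i \<in> set us" for i using S\<kappa>[OF f'S[OF n_us[OF that]]] .
      then show ?thesis by (simp add: upd_def f'_def)
    qed
    fix g assume g: "upd (set vs) (V \<kappa>) f' g"
    show "true g \<delta>"
    proof -
      have inf\<xi>: "infinite (V \<xi>)" using up\<xi> \<xi>(2) by (rule upclosed_infinite)
      \<comment> \<open>The values of \<open>g\<close> may be too large to be coded on
        \<open>V \<xi>\<close>. They are shrunk with the truth value of \<delta> kept and
        \<open>S\<close>, which contains the relevant values of \<open>f'\<close>, fixed.\<close>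
      obtain g' T' where T': "trans_class T'" "S \<subseteq> T'" "T' \<lesssim> V \<xi>" "range g' \<subseteq> T'"
        and g': "\<And>i. g i \<in> S \<Longrightarrow> g' i = g i" "true g' \<delta> \<longleftrightarrow> true g \<delta>"
        using Delta0_Loewenheim_Skolem[OF \<delta> inf\<xi> small_V trS SV, of g] by metis
      have smT': "small T'" using small_V T'(3) by (rule small_lepoll)
      obtain F' \<rho>' where F': "F' \<subseteq> V \<xi> \<times> V \<xi>" "wf F'" "extensional_rel F'" "extends E F'"
        "decodes \<rho>' F'" "\<rho>' ` Domain F' = T'"
        using exists_extension[OF up\<xi> \<xi>(2) EV \<pi> exE T'(1) T'(2)[unfolded S_def] T'(3) smT'] .
      obtain Y where Y: "Y \<subseteq> V \<xi>" "rel Y = F'" using exists_rel[OF up\<xi> F'(1)] .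
      have "\<exists>a. a \<in> Domain F' \<and> \<rho>' a = g' i" for i
      proof -
        have "g' i \<in> \<rho>' ` Domain F'" unfolding F'(6) using T'(4) by auto
        then show ?thesis by auto
      qed
      then obtain a where a: "\<And>i. a i \<in> Domain F'" "\<And>i. \<rho>' (a i) = g' i" by metis
      \<comment> \<open>On the universal block \<open>h\<close> holds codes of the shrunken values.
        Elsewhere below \<open>n\<close> it holds \<open>sing (c i)\<close>, the code that
        \<open>F'\<close> assigns to \<open>f' i\<close>.\<close>
      define h where "h i = (if i \<in> set vs then a i else d' i)" for i
      have "Domain F' \<subseteq> V \<xi>" using F'(1) by auto
      then have h: "upd (set vs) (V \<xi>) d' h" using a(1) by (auto simp: upd_def h_def)
      have hD: "h i \<in> Domain F'" if "i < n" for i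
        using that a(1) F'(4) cE d'c by (simp add: h_def extends_def)
      have "sat (V \<xi>) X' Y h (codeF \<delta>)"
        \<comment> \<open>\<open>F'\<close> is well-founded, which implies the weaker first-order
          condition in any structure; hence \<open>Y\<close> is among the relations that the
          reflected statement speaks of.\<close>
        using coded[OF Y(1) Y(1)] F'(3,4) wf_set_founded[OF F'(2)] h a(1)
        unfolding Y(2) E_def[symmetric] by (simp add: h_def)
      then have "true (\<rho>' \<circ> h) \<delta>"
        using sat_codeF[OF trans_class_V X' Y(1) \<delta> n(1), unfolded Y(2),
            OF F'(5) decodes_inj[OF F'(5,3)] upd_range[OF h d'V] hD] by blast
      moreover have "true (\<rho>' \<circ> h) \<delta> \<longleftrightarrow> true g' \<delta>"
      proof (rule sat_cong[OF n(1)])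
        fix i assume i: "i < n"
        show "(\<rho>' \<circ> h) i = g' i"
        proof (cases "i \<in> set vs")
          case False
          then have "g i = f' i" using g by (simp add: upd_def)
          then have "g' i = f' i" using g'(1)[of i] f'S[OF i] by simp
          moreover have "\<rho>' (sing (c i)) = \<pi> (c i)"
            using decodes_extends[OF \<pi> F'(5,4) cE[OF i]] .
          ultimately show ?thesis using False d'c[OF i] \<pi>c[OF i] by (simp add: h_def)
        qed (simp add: h_def a(2))
      qed
      ultimately show ?thesis using g'(2) by blast
    qed
  qed
qed

lemma reflection_imp_Sigma_elementary:
  assumes refl: "Sigma12_reflection \<kappa>"
  shows "Sigma_elementary 2 (H \<kappa>) (H (card_succ \<kappa>))"
  unfolding Sigma_elementary_iff
proof (intro allI impI iffI; elim exE conjE)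
  fix us vs \<delta> e f
  assume \<delta>: "\<delta> \<in> Delta0" and e: "range e \<subseteq> V \<kappa>" and f: "upd (set us) (V \<kappa>) e f"
    and true: "\<forall>g. upd (set vs) (V \<kappa>) f g \<longrightarrow> true g \<delta>"
  have "upd (set us) (H (card_succ \<kappa>)) e f" using f V_\<kappa>_subset_H_card_succ by (auto simp: upd_def)
  moreover have "true g \<delta>" if "upd (set vs) (H (card_succ \<kappa>)) f g" for g
  proof (rule Pi1_upward[OF \<delta> upd_range[OF f e]])
    show "true g \<delta>" if "upd (set vs) (V \<kappa>) f g" for g using true that by blast
    show "g i = f i" if "i \<notin> set vs" for i
      using \<open>upd (set vs) (H (card_succ \<kappa>)) f g\<close> that by (simp add: upd_def)
  qed
  ultimately show "\<exists>f. upd (set us) (H (card_succ \<kappa>)) e f \<and>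
      (\<forall>g. upd (set vs) (H (card_succ \<kappa>)) f g \<longrightarrow> true g \<delta>)" by blast
next
  fix us vs \<delta> e f
  assume \<delta>: "\<delta> \<in> Delta0" and e: "range e \<subseteq> V \<kappa>" and f: "upd (set us) (H (card_succ \<kappa>)) e f"
    and true: "\<forall>g. upd (set vs) (H (card_succ \<kappa>)) f g \<longrightarrow> true g \<delta>"
  obtain f' where "upd (set us) (V \<kappa>) e f'" "\<And>g. upd (set vs) (V \<kappa>) f' g \<Longrightarrow> true g \<delta>"
    using Sigma2_downward[OF refl \<delta> e f] true by metis
  then show "\<exists>f. upd (set us) (V \<kappa>) e f \<and> (\<forall>g. upd (set vs) (V \<kappa>) f g \<longrightarrow> true g \<delta>)" by blast
qed

end

theorem fact3p2:
  fixes elts :: "'v \<Rightarrow> 'v set" and \<kappa> :: 'v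
  assumes "zfc_universe elts"
    and "zfc_universe.cardinal elts \<kappa>"
  shows "zfc_universe.Sigma12_indescribable elts \<kappa> \<longleftrightarrow>
    zfc_universe.inaccessible elts \<kappa> \<and>
    zfc_universe.Sigma_elementary elts 2
      (zfc_universe.H elts \<kappa>) (zfc_universe.H elts (zfc_universe.card_succ elts \<kappa>))"
proof -
  interpret zfc_universe elts by fact
  have "Sigma12_reflection \<kappa> \<longleftrightarrow> Sigma_elementary 2 (H \<kappa>) (H (card_succ \<kappa>))" if "inaccessible \<kappa>"
  proof -
    interpret inaccessible_cardinal elts \<kappa> by unfold_locales (rule that)
    show ?thesis
      using Sigma_elementary_imp_reflection reflection_imp_Sigma_elementary by blast
  qed
  then show ?thesis unfolding Sigma12_indescribable_def by blast
qed

end
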